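(* Let $\iota$ be a positive integer, $0<q\leq 1\leq r\leq\infty$, $\varepsilon\geq 0$, and $A\in\mathbb{R}^{m\times n}$. Let $D_1\in\mathbb{R}^{n\times d_1},\dots,D_\iota\in\mathbb{R}^{n\times d_\iota}$ be arbitrary tight frames for $\mathbb{R}^n$ with frame bound $1$; set $\bar{d}=d_1+\cdots+d_\iota$, $$\bar{D}=[D_1|D_2|\cdots|D_\iota]\in\mathbb{R}^{n\times\bar d},\quad \Psi=\mathrm{diag}(D_1,D_2,\dots,D_\iota)\in\mathbb{R}^{\iota n\times\bar d},\quad f=(f_1^T,\dots,f_\iota^T)^T\in\mathbb{R}^{\iota n},$$ and suppose we observe $y=A(f_1+\cdots+f_\iota)+z$ with $\|z\|_r\leq\varepsilon$. Let $s=s_1+\cdots+s_\iota$ for given positive integers $s_1,\dots,s_\iota$, and fix a positive integer $a>s$; set $\rho=s/a$ and $\Delta=\frac{1+\delta_a}{1-\delta_{s+a}}$, where $\delta_k$ are the $(\bar{D},q)$-RIP constants of $A$. Assume that the mutual coherence $\mu_1$ between $D_1,\dots,D_\iota$ satisfies $$\mu_1(s+a)(\rho^{2/q-1}+1)<1,$$ and that $$\Delta\rho^{1-q/2}(\rho^{2/q-1}+1)^{q/2}<(2\iota)^{-q/2}.$$ Then any solution $\hat{f}$ of $$\min_{\tilde{f}\in\mathbb{R}^{\iota n}}\|\Psi^*\tilde{f}\|_q\quad\text{subject to}\quad\|A\bar{D}\Psi^*\tilde{f}-y\|_r\leq\varepsilon$$ obeys $$\|\hat{f}-f\|_2\leq\tilde{C}_1\frac{\|\Psi^*f-(\Psi^*f)_{[s]}\|_q}{s^{1/q-1/2}}+\tilde{C}_2m^{1/q-1/r}\varepsilon$$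 and $$\|\Psi^*\hat{f}-\Psi^*f\|_q^q\leq\tilde{C}_3\|\Psi^*f-(\Psi^*f)_{[s]}\|_q^q+\tilde{C}_4a^{1-q/2}m^{1-q/r}\varepsilon^q,$$ where $\tilde{C}_1,\tilde{C}_2,\tilde{C}_3,\tilde{C}_4$ are positive constants depending only on $\delta_a$, $\delta_{s+a}$, $\rho$, $\iota$ and $q$.
   Context: A tight frame for $\mathbb{R}^n$ with frame bound $1$ is $D\in\mathbb{R}^{n\times d}$ with $\|D^*g\|_2=\|g\|_2$ for all $g\in\mathbb{R}^n$ (equivalently $DD^*=I$); note $\bar D\Psi^*\tilde f=\sum_k D_kD_k^*\tilde f_k=\sum_k\tilde f_k$. $A$ obeys the $(\bar{D},q)$-RIP of order $k$ with constant $\delta\in[0,1)$ if $(1-\delta)\|\bar{D}v\|_2^q\leq\|A\bar{D}v\|_q^q\leq(1+\delta)\|\bar{D}v\|_2^q$ for all $v\in\mathbb{R}^{\bar d}$ with at most $k$ nonzero entries; $\delta_k$ is the smallest such $\delta$. If $D_k$ has columns $d_{k1},\dots,d_{kd_k}$, the mutual coherence is $\mu_1=\max_{k\neq l}\max_{i,j}|\langle d_{ki},d_{lj}\rangle|$. $x_{[s]}$ keeps the $s$ largest entries of $x$ in magnitude and zeros the rest. *)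

theory Defs
  imports Complex_Main "HOL-Library.Extended_Real"
begin

text \<open>Vectors are functions into real, considered on an explicit finite index set.
  A vector in R^n is a function nat => real on {..<n}; a matrix is nat => nat => real.
  The frame D_k is D k (entries D k i j, row i < n, column j < d k).
  Coefficient vectors in R^dbar are indexed by pairs (k,j) with k < iota and j < d k.
  Block vectors in R^(iota n) are functions nat => nat => real, block k, entry i.\<close>

definition qpow_sum :: "'i set \<Rightarrow> real \<Rightarrow> ('i \<Rightarrow> real) \<Rightarrow> real" where
  "qpow_sum I p x = (\<Sum>i\<in>I. \<bar>x i\<bar> powr p)"

definition pnorm :: "'i set \<Rightarrow> real \<Rightarrow> ('i \<Rightarrow> real) \<Rightarrow> real" where
  "pnorm I p x = (qpow_sum I p x) powr (1 / p)"

definition rnorm :: "'i set \<Rightarrow> ereal \<Rightarrow> ('i \<Rightarrow> real) \<Rightarrow> real" where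
  "rnorm I r x = (if r = \<infinity> then (if I = {} then 0 else Max ((\<lambda>i. \<bar>x i\<bar>) ` I))
                  else pnorm I (real_of_ereal r) x)"

definition einv :: "ereal \<Rightarrow> real" where
  "einv r = (if r = \<infinity> then 0 else 1 / real_of_ereal r)"

definition matvec :: "nat \<Rightarrow> (nat \<Rightarrow> nat \<Rightarrow> real) \<Rightarrow> (nat \<Rightarrow> real) \<Rightarrow> nat \<Rightarrow> real" where
  "matvec n A x = (\<lambda>i. \<Sum>j<n. A i j * x j)"

definition coef_idx :: "nat \<Rightarrow> (nat \<Rightarrow> nat) \<Rightarrow> (nat \<times> nat) set" where
  "coef_idx \<iota> d = Sigma {..<\<iota>} (\<lambda>k. {..<d k})"

definition Dbar_mult :: "nat \<Rightarrow> (nat \<Rightarrow> nat) \<Rightarrow> (nat \<Rightarrow> nat \<Rightarrow> nat \<Rightarrow> real)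
    \<Rightarrow> (nat \<times> nat \<Rightarrow> real) \<Rightarrow> nat \<Rightarrow> real" where
  "Dbar_mult \<iota> d D v = (\<lambda>i. \<Sum>p\<in>coef_idx \<iota> d. D (fst p) i (snd p) * v p)"

definition Psi_adj :: "nat \<Rightarrow> (nat \<Rightarrow> nat \<Rightarrow> nat \<Rightarrow> real) \<Rightarrow> (nat \<Rightarrow> nat \<Rightarrow> real)
    \<Rightarrow> nat \<times> nat \<Rightarrow> real" where
  "Psi_adj n D ft = (\<lambda>p. \<Sum>i<n. D (fst p) i (snd p) * ft (fst p) i)"

definition tight_frame1 :: "nat \<Rightarrow> nat \<Rightarrow> (nat \<Rightarrow> nat \<Rightarrow> real) \<Rightarrow> bool" where
  "tight_frame1 n dk Dk \<longleftrightarrow>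
     (\<forall>g::nat \<Rightarrow> real. pnorm {..<dk} 2 (\<lambda>j. \<Sum>i<n. Dk i j * g i) = pnorm {..<n} 2 g)"

definition mutual_coherence :: "nat \<Rightarrow> nat \<Rightarrow> (nat \<Rightarrow> nat) \<Rightarrow> (nat \<Rightarrow> nat \<Rightarrow> nat \<Rightarrow> real) \<Rightarrow> real" where
  "mutual_coherence n \<iota> d D =
     (let S = {\<bar>\<Sum>i<n. D k i a * D l i b\<bar> | k l a b. k < \<iota> \<and> l < \<iota> \<and> k \<noteq> l \<and> a < d k \<and> b < d l}
      in if S = {} then 0 else Max S)"

definition rip_holds :: "nat \<Rightarrow> nat \<Rightarrow> nat \<Rightarrow> (nat \<Rightarrow> nat) \<Rightarrow> (nat \<Rightarrow> nat \<Rightarrow> nat \<Rightarrow> real)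
    \<Rightarrow> (nat \<Rightarrow> nat \<Rightarrow> real) \<Rightarrow> real \<Rightarrow> nat \<Rightarrow> real \<Rightarrow> bool" where
  "rip_holds m n \<iota> d D A q k \<delta> \<longleftrightarrow>
     (\<forall>v. card {p \<in> coef_idx \<iota> d. v p \<noteq> 0} \<le> k \<longrightarrow>
        (1 - \<delta>) * (pnorm {..<n} 2 (Dbar_mult \<iota> d D v)) powr q
           \<le> qpow_sum {..<m} q (matvec n A (Dbar_mult \<iota> d D v)) \<and>
        qpow_sum {..<m} q (matvec n A (Dbar_mult \<iota> d D v))
           \<le> (1 + \<delta>) * (pnorm {..<n} 2 (Dbar_mult \<iota> d D v)) powr q)"

definition rip_const :: "nat \<Rightarrow> nat \<Rightarrow> nat \<Rightarrow> (nat \<Rightarrow> nat) \<Rightarrow> (nat \<Rightarrow> nat \<Rightarrow> nat \<Rightarrow> real)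
    \<Rightarrow> (nat \<Rightarrow> nat \<Rightarrow> real) \<Rightarrow> real \<Rightarrow> nat \<Rightarrow> real" where
  "rip_const m n \<iota> d D A q k = Inf {\<delta>. 0 \<le> \<delta> \<and> \<delta> < 1 \<and> rip_holds m n \<iota> d D A q k \<delta>}"

definition top_set :: "'i set \<Rightarrow> nat \<Rightarrow> ('i \<Rightarrow> real) \<Rightarrow> 'i set \<Rightarrow> bool" where
  "top_set I s x S \<longleftrightarrow> S \<subseteq> I \<and> card S = min s (card I) \<and>
     (\<forall>i\<in>S. \<forall>j\<in>I - S. \<bar>x j\<bar> \<le> \<bar>x i\<bar>)"

definition best_s :: "'i set \<Rightarrow> nat \<Rightarrow> ('i \<Rightarrow> real) \<Rightarrow> 'i \<Rightarrow> real" where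
  "best_s I s x = (let S = (SOME S. top_set I s x S) in (\<lambda>i. if i \<in> S then x i else 0))"

end

theory Submission
  imports Defs "HOL-Analysis.Convex"
begin

text \<open>
  Let \<open>f'\<close> be the minimizer and \<open>w = \<Psi>\<^sup>* (f' - f)\<close>. Let \<open>T\<^sub>0\<close> carry the \<open>s\<close> largest
  entries of \<open>\<Psi>\<^sup>* f\<close>, let \<open>T\<^sub>1\<close> carry the \<open>a\<close> largest entries of \<open>w\<close> off \<open>T\<^sub>0\<close>, and let \<open>u\<close> be the
  restriction of \<open>w\<close> to \<open>T = T\<^sub>0 \<union> T\<^sub>1\<close>. Minimality puts \<open>w\<close> in a cone, so the part of \<open>w\<close> off \<open>T\<close>
  is controlled by \<open>\<parallel>u\<parallel>\<close> and the (scaled) tail \<open>e\<close> of \<open>\<Psi>\<^sup>* f\<close>.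

  Coherence makes the blocks \<open>D\<^sub>k v\<^sub>k\<close> of a sparse \<open>v\<close> almost orthogonal. Hence
  \<open>\<parallel>Dbar v\<parallel>\<^sup>2 \<le> 2 \<parallel>v\<parallel>\<^sup>2\<close> for \<open>a\<close>-sparse \<open>v\<close>, while for \<open>u\<close> one has
  \<open>\<parallel>Dbar u\<parallel>\<^sup>2 \<ge> \<parallel>\<Psi> u\<parallel>\<^sup>2 - (1 - 1/\<iota>) \<parallel>u\<parallel>\<^sup>2 / (1 + \<rho> powr (2/q - 1))\<close>, and
  \<open>\<parallel>u\<parallel>\<^sup>4 = \<langle>\<Psi> u, f' - f\<rangle>\<^sup>2 \<le> \<parallel>\<Psi> u\<parallel>\<^sup>2 \<parallel>w\<parallel>\<^sup>2\<close>. Inserting both bounds into the RIP leaves, for \<open>e = 0\<close>,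
  exactly the factor \<open>2 \<iota> (1 + \<rho> powr (2/q - 1))\<close> of the hypothesis on \<open>\<Delta>\<close>.

  By continuity there is room for a small \<open>\<theta>\<close> depending only on \<open>\<delta>\<^sub>a\<close>, \<open>\<delta>\<^sub>s\<^sub>+\<^sub>a\<close>, \<open>\<rho>\<close>, \<open>\<iota>\<close>, \<open>q\<close>: if
  \<open>e \<le> \<theta> \<parallel>u\<parallel>\<^sup>q\<close> the noise bounds \<open>\<parallel>u\<parallel>\<close>, and otherwise \<open>\<parallel>u\<parallel>\<^sup>q < e / \<theta>\<close>.
\<close>

section \<open>Real powers and q-sums\<close>

lemma powr_add_le_add_powr:
  fixes x y p :: real
  assumes "0 \<le> x" "0 \<le> y" "0 \<le> p" "p \<le> 1"
  shows "(x + y) powr p \<le> x powr p + y powr p"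
proof (cases "x + y = 0")
  case True
  then show ?thesis using assms by simp
next
  case False
  with assms have pos: "x + y > 0" by linarith
  \<comment> \<open>After division by \<open>x + y\<close> both parts lie in [0,1], where lowering
    the exponent from 1 to \<open>p\<close> can only increase the value; the two parts add up to
    1.\<close>
  have *: "t / (x + y) \<le> (t / (x + y)) powr p" if "0 \<le> t" "t \<le> x + y" for t
  proof (cases "t = 0")
    case False
    then have "(t / (x + y)) powr 1 \<le> (t / (x + y)) powr p"
      using that pos assms by (intro powr_mono') auto
    then show ?thesis using that pos False by simp
  qed simp
  have "1 = x / (x + y) + y / (x + y)"
    using pos by (simp flip: add_divide_distrib)
  also have "\<dots> \<le> (x / (x + y)) powr p + (y / (x + y)) powr p"
    using *[of x] *[of y] assms by linarith
  also have "\<dots> = (x powr p + y powr p) / (x + y) powr p"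
    using assms pos by (simp add: powr_divide add_divide_distrib)
  finally show ?thesis using pos by (simp add: divide_simps)
qed

lemma add_powr_le:
  fixes x y p :: real
  assumes "0 \<le> x" "0 \<le> y" "0 \<le> p"
  shows "(x + y) powr p \<le> 2 powr p * (x powr p + y powr p)"
proof -
  have "(x + y) powr p \<le> (2 * max x y) powr p"
    using assms by (intro powr_mono2) auto
  also have "\<dots> = 2 powr p * max x y powr p"
    using assms by (simp add: powr_mult)
  also have "max x y powr p \<le> x powr p + y powr p"
    by (simp add: max_def)
  finally show ?thesis by simp
qed

text \<open>Jensen's inequality for the convex function \<open>t powr p\<close> with equal weights.
  It is applied on the support \<open>K\<close> because convexity is invoked on the open half-line;
  passing back to \<open>card I\<close> is harmless since the exponent \<open>1 - 1 / p\<close> is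
  nonnegative.\<close>

lemma sum_le_card_powr_mult:
  fixes f :: "'i \<Rightarrow> real"
  assumes fin: "finite I" and nn: "\<And>i. i \<in> I \<Longrightarrow> 0 \<le> f i" and p: "1 \<le> p"
  shows "(\<Sum>i\<in>I. f i) \<le> real (card I) powr (1 - 1 / p) * (\<Sum>i\<in>I. f i powr p) powr (1 / p)"
proof -
  define K where "K = {i \<in> I. f i \<noteq> 0}"
  have K: "finite K" "K \<subseteq> I" and pos: "\<And>i. i \<in> K \<Longrightarrow> 0 < f i"
    using fin nn by (auto simp: K_def order.strict_iff_order)
  have S1: "(\<Sum>i\<in>I. f i) = (\<Sum>i\<in>K. f i)"
    using fin by (intro sum.mono_neutral_right) (auto simp: K_def)
  have S2: "(\<Sum>i\<in>I. f i powr p) = (\<Sum>i\<in>K. f i powr p)"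
    using fin by (intro sum.mono_neutral_right) (auto simp: K_def)
  show ?thesis
  proof (cases "K = {}")
    case True
    then show ?thesis using S1 by simp
  next
    case False
    define c where "c = real (card K)"
    have c: "c > 0" using K False by (auto simp: c_def card_gt_0_iff)
    have "(\<Sum>i\<in>K. (1 / c) *\<^sub>R f i) powr p \<le> (\<Sum>i\<in>K. (1 / c) * (f i powr p))"
      using powr_convex[OF p] K False c pos
      by (intro convex_on_sum[where C = "{0<..}"]) (auto simp: c_def)
    then have "((\<Sum>i\<in>K. f i) / c) powr p \<le> (\<Sum>i\<in>K. f i powr p) / c"
      by (simp flip: sum_divide_distrib)
    then have "(((\<Sum>i\<in>K. f i) / c) powr p) powr (1 / p) \<le> ((\<Sum>i\<in>K. f i powr p) / c) powr (1 / p)"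
      using p by (intro powr_mono2) auto
    then have "(\<Sum>i\<in>K. f i) / c \<le> (\<Sum>i\<in>K. f i powr p) powr (1 / p) / c powr (1 / p)"
      using p c pos by (simp add: powr_powr powr_divide sum_nonneg less_imp_le)
    then have "(\<Sum>i\<in>K. f i) \<le> c powr (1 - 1 / p) * (\<Sum>i\<in>K. f i powr p) powr (1 / p)"
      using c by (simp add: powr_diff field_simps)
    also have "\<dots> \<le> real (card I) powr (1 - 1 / p) * (\<Sum>i\<in>K. f i powr p) powr (1 / p)"
      using K fin p by (intro mult_right_mono powr_mono2) (auto simp: c_def card_mono)
    finally show ?thesis by (simp add: S1 S2)
  qed
qed

lemma qpow_sum_nonneg [simp]: "0 \<le> qpow_sum I q x"
  by (simp add: qpow_sum_def sum_nonneg)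

lemma qpow_sum_two: "qpow_sum I 2 x = (\<Sum>i\<in>I. (x i)\<^sup>2)"
  by (simp add: qpow_sum_def powr_numeral)

lemma pnorm_two_powr: "pnorm I 2 x powr q = (\<Sum>i\<in>I. (x i)\<^sup>2) powr (q / 2)"
  by (simp add: pnorm_def qpow_sum_two powr_powr)

lemma pnorm_powr: "q \<noteq> 0 \<Longrightarrow> pnorm I q x powr q = qpow_sum I q x"
  by (simp add: pnorm_def powr_powr)

lemma qpow_sum_add_le:
  assumes "0 \<le> q" "q \<le> 1"
  shows "qpow_sum I q (\<lambda>i. x i + y i) \<le> qpow_sum I q x + qpow_sum I q y"
proof -
  have "\<bar>x i + y i\<bar> powr q \<le> \<bar>x i\<bar> powr q + \<bar>y i\<bar> powr q" for i
    using powr_mono2[of q "\<bar>x i + y i\<bar>" "\<bar>x i\<bar> + \<bar>y i\<bar>"]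
      powr_add_le_add_powr[of "\<bar>x i\<bar>" "\<bar>y i\<bar>" q] assms by (smt (verit))
  then show ?thesis
    by (simp add: qpow_sum_def sum_mono flip: sum.distrib)
qed

text \<open>The power-mean bound for the numbers \<open>f i powr q\<close> with exponent
  \<open>p / q\<close>. It serves to pass from the q-sum of the noise to its r-norm, and from the
  q-sum of the head to its Euclidean norm.\<close>

lemma powr_card_sum_le:
  fixes f :: "'i \<Rightarrow> real"
  assumes fin: "finite I" and nn: "\<And>i. i \<in> I \<Longrightarrow> 0 \<le> f i" and q: "0 < q" "q \<le> p"
  shows "(\<Sum>i\<in>I. f i powr q) \<le> real (card I) powr (1 - q / p) * (\<Sum>i\<in>I. f i powr p) powr (q / p)"
  using sum_le_card_powr_mult[of I "\<lambda>i. f i powr q" "p / q"] assms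
  by (simp add: powr_powr)

text \<open>Meant for the residuals of \<open>f\<close> and of the minimizer: both are within
  \<open>\<epsilon>\<close>, and their difference is the measurement of the error. The power of
  \<open>m\<close> is the price of going from the r-norm to the q-sum.\<close>

lemma rnorm_diff_powr_le:
  assumes r: "1 \<le> r" and q: "0 < q" "q \<le> 1" and m: "0 < m" and eps: "0 \<le> \<epsilon>"
    and u: "rnorm {..<m} r u \<le> \<epsilon>" and v: "rnorm {..<m} r v \<le> \<epsilon>"
  shows "qpow_sum {..<m} q (\<lambda>i. u i - v i) \<le> real m powr (1 - q * einv r) * (2 * \<epsilon>) powr q"
proof (cases "r = \<infinity>")
  case True
  have bd: "\<bar>w i\<bar> \<le> \<epsilon>" if "rnorm {..<m} r w \<le> \<epsilon>" "i < m" for w i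
  proof -
    have "\<bar>w i\<bar> \<le> Max ((\<lambda>i. \<bar>w i\<bar>) ` {..<m})" using that by (intro Max_ge) auto
    also have "\<dots> \<le> \<epsilon>" using that m True by (auto simp: rnorm_def split: if_splits)
    finally show ?thesis .
  qed
  have "qpow_sum {..<m} q (\<lambda>i. u i - v i) \<le> (\<Sum>i<m. (2 * \<epsilon>) powr q)"
    unfolding qpow_sum_def
  proof (intro sum_mono powr_mono2)
    fix i assume "i \<in> {..<m}"
    then show "\<bar>u i - v i\<bar> \<le> 2 * \<epsilon>"
      using bd[OF u, of i] bd[OF v, of i] by auto
  qed (use q in auto)
  also have "\<dots> = real m powr (1 - q * einv r) * (2 * \<epsilon>) powr q"
    using True m by (simp add: einv_def)
  finally show ?thesis .
next
  case False
  define p where "p = real_of_ereal r"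
  have p: "1 \<le> p" and rp: "r = ereal p"
    using r False by (cases r; simp add: p_def)+
  have bd: "(\<Sum>i<m. \<bar>w i\<bar> powr p) \<le> \<epsilon> powr p" if "rnorm {..<m} r w \<le> \<epsilon>" for w
  proof -
    have "pnorm {..<m} p w \<le> \<epsilon>" using that False by (simp add: rnorm_def p_def)
    then have "pnorm {..<m} p w powr p \<le> \<epsilon> powr p"
      using p by (intro powr_mono2) (auto simp: pnorm_def)
    then show ?thesis using p by (simp add: pnorm_powr) (simp add: qpow_sum_def)
  qed
  \<comment> \<open>Jensen over the two-element index type \<open>bool\<close>. Since
    \<open>u\<close> and \<open>v\<close> obey the same bound, this replaces Minkowski's inequality:
    \<open>2 powr (p - 1)\<close> times two copies of \<open>\<epsilon> powr p\<close> is exactly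
    \<open>(2 * \<epsilon>) powr p\<close>.\<close>
  have cvx: "(x + y) powr p \<le> 2 powr (p - 1) * (x powr p + y powr p)" if "0 \<le> x" "0 \<le> y" for x y :: real
  proof -
    have "x + y \<le> 2 powr (1 - 1 / p) * (x powr p + y powr p) powr (1 / p)"
      using sum_le_card_powr_mult[of "UNIV :: bool set" "\<lambda>b. if b then x else y" p] that p
      by (simp add: UNIV_bool add.commute split: if_splits)
    then have "(x + y) powr p \<le> (2 powr (1 - 1 / p) * (x powr p + y powr p) powr (1 / p)) powr p"
      using that p by (intro powr_mono2) auto
    also have "\<dots> = 2 powr (p - 1) * (x powr p + y powr p)"
      using p by (simp add: powr_mult powr_powr algebra_simps)
    finally show ?thesis .
  qed
  have "(\<Sum>i<m. \<bar>u i - v i\<bar> powr p) \<le> (\<Sum>i<m. 2 powr (p - 1) * (\<bar>u i\<bar> powr p + \<bar>v i\<bar> powr p))"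
  proof (intro sum_mono)
    fix i
    have "\<bar>u i - v i\<bar> powr p \<le> (\<bar>u i\<bar> + \<bar>v i\<bar>) powr p"
      using p by (intro powr_mono2) auto
    also have "\<dots> \<le> 2 powr (p - 1) * (\<bar>u i\<bar> powr p + \<bar>v i\<bar> powr p)" by (rule cvx) auto
    finally show "\<bar>u i - v i\<bar> powr p \<le> 2 powr (p - 1) * (\<bar>u i\<bar> powr p + \<bar>v i\<bar> powr p)" .
  qed
  also have "\<dots> = 2 powr (p - 1) * ((\<Sum>i<m. \<bar>u i\<bar> powr p) + (\<Sum>i<m. \<bar>v i\<bar> powr p))"
    by (simp add: sum_distrib_left sum.distrib distrib_left)
  also have "\<dots> \<le> 2 powr (p - 1) * (\<epsilon> powr p + \<epsilon> powr p)"
    using bd[OF u] bd[OF v] by (intro mult_left_mono add_mono) auto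
  also have "\<dots> = (2 * \<epsilon>) powr p"
    using eps by (simp add: powr_mult powr_diff)
  finally have *: "(\<Sum>i<m. \<bar>u i - v i\<bar> powr p) \<le> (2 * \<epsilon>) powr p" .
  have "qpow_sum {..<m} q (\<lambda>i. u i - v i)
      \<le> real m powr (1 - q / p) * (\<Sum>i<m. \<bar>u i - v i\<bar> powr p) powr (q / p)"
    using powr_card_sum_le[of "{..<m}" "\<lambda>i. \<bar>u i - v i\<bar>" q p] q p by (simp add: qpow_sum_def)
  also have "\<dots> \<le> real m powr (1 - q / p) * ((2 * \<epsilon>) powr p) powr (q / p)"
    using * q p by (intro mult_left_mono powr_mono2) (auto simp: sum_nonneg)
  also have "\<dots> = real m powr (1 - q * einv r) * (2 * \<epsilon>) powr q"
    using p rp by (simp add: powr_powr einv_def)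
  finally show ?thesis .
qed

section \<open>Largest entries and decreasing blocks\<close>

text \<open>Greedy construction: a largest remaining entry is added at each step. Existence gives
  meaning to the \<open>SOME\<close> in \<open>best_s\<close> and supplies the successive blocks
  below.\<close>

lemma top_set_exists:
  assumes "finite I"
  shows "\<exists>S. top_set I k x S"
proof (induction k)
  case 0
  show ?case using assms by (intro exI[of _ "{}"]) (simp add: top_set_def)
next
  case (Suc k)
  then obtain S where S: "S \<subseteq> I" "card S = min k (card I)"
    "\<And>i j. i \<in> S \<Longrightarrow> j \<in> I - S \<Longrightarrow> \<bar>x j\<bar> \<le> \<bar>x i\<bar>"
    by (auto simp: top_set_def)
  have finS: "finite S" using S assms finite_subset by blast
  show ?case
  proof (cases "S = I")
    case True
    then show ?thesis using S by (intro exI[of _ S]) (auto simp: top_set_def)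
  next
    case False
    then have ne: "I - S \<noteq> {}" using S by blast
    obtain m where m: "m \<in> I - S" "\<And>j. j \<in> I - S \<Longrightarrow> \<bar>x j\<bar> \<le> \<bar>x m\<bar>"
      using obtains_MAX[of "I - S" "\<lambda>i. \<bar>x i\<bar>"] assms ne
      by (metis (no_types, lifting) Max_ge finite_Diff finite_imageI imageI)
    have "card S < card I" using S False assms by (metis psubsetI psubset_card_mono)
    then have "card (insert m S) = min (Suc k) (card I)"
      using finS m S by auto
    then show ?thesis using S m by (intro exI[of _ "insert m S"]) (auto simp: top_set_def)
  qed
qed

text \<open>Every entry off \<open>T\<close> is dominated by each entry of \<open>T\<close>, so its
  q-th power is at most the average \<open>avg\<close> over \<open>T\<close>; at most
  \<open>a\<close> such entries are then summed.\<close>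

lemma top_set_powr_le:
  fixes q :: real
  assumes T: "top_set I a w T" "finite I" "0 < a" and S: "S \<subseteq> I - T" "card S \<le> a" and q: "0 < q"
  shows "(\<Sum>i\<in>S. (w i)\<^sup>2) powr (q / 2) \<le> real a powr (q / 2 - 1) * qpow_sum T q w"
proof (cases "S = {}")
  case False
  have finT: "finite T" using T by (auto simp: top_set_def intro: finite_subset)
  have "T \<subset> I" using False S T by (auto simp: top_set_def)
  then have "card T < card I" using T by (intro psubset_card_mono)
  \<comment> \<open>Something remains outside \<open>T\<close>, so the minimum in
    \<open>top_set\<close> is \<open>a\<close>; the average really runs over \<open>a\<close>
    entries.\<close>
  then have cT: "card T = a" using T by (auto simp: top_set_def min_def split: if_splits)
  define avg where "avg = qpow_sum T q w / real a"
  have avg: "0 \<le> avg" by (simp add: avg_def)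
  have "(w i)\<^sup>2 \<le> avg powr (2 / q)" if "i \<in> S" for i
  proof -
    have "real a * \<bar>w i\<bar> powr q = (\<Sum>j\<in>T. \<bar>w i\<bar> powr q)" by (simp add: cT)
    also have "\<dots> \<le> qpow_sum T q w"
      unfolding qpow_sum_def using T S that q
      by (intro sum_mono powr_mono2) (auto simp: top_set_def)
    finally have "\<bar>w i\<bar> powr q \<le> avg" using T by (simp add: avg_def field_simps)
    then have "(\<bar>w i\<bar> powr q) powr (2 / q) \<le> avg powr (2 / q)" using q by (intro powr_mono2) auto
    then show ?thesis using q by (simp add: powr_powr powr_numeral)
  qed
  then have "(\<Sum>i\<in>S. (w i)\<^sup>2) \<le> real (card S) * avg powr (2 / q)"
    by (rule sum_bounded_above)
  also have "\<dots> \<le> real a * avg powr (2 / q)" using S by (intro mult_right_mono) auto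
  finally have "(\<Sum>i\<in>S. (w i)\<^sup>2) powr (q / 2) \<le> (real a * avg powr (2 / q)) powr (q / 2)"
    using q by (intro powr_mono2) (auto simp: sum_nonneg)
  also have "\<dots> = real a powr (q / 2) * avg"
    using q avg by (simp add: powr_mult powr_powr)
  also have "\<dots> = real a powr (q / 2 - 1) * qpow_sum T q w"
    using T by (simp add: avg_def powr_diff)
  finally show ?thesis .
qed simp

text \<open>Peeling off blocks of size \<open>a\<close> in decreasing order of magnitude, each block but the
  first is controlled by its predecessor.\<close>

lemma top_set_remainder_le:
  fixes \<Phi> :: "'i set \<Rightarrow> real"
  assumes J: "finite J" and a: "0 < a" and q: "0 < q" and c: "0 \<le> c"
    and sub: "\<And>S T. S \<inter> T = {} \<Longrightarrow> S \<union> T \<subseteq> J \<Longrightarrow> \<Phi> (S \<union> T) \<le> \<Phi> S + \<Phi> T"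
    and bd: "\<And>S. S \<subseteq> J \<Longrightarrow> card S \<le> a \<Longrightarrow> \<Phi> S \<le> c * (\<Sum>i\<in>S. (w i)\<^sup>2) powr (q / 2)"
    and T: "top_set J a w T"
  shows "\<Phi> (J - T) \<le> c * (real a powr (q / 2 - 1) * qpow_sum J q w)"
  using J sub bd T
proof (induction "card J" arbitrary: J T rule: less_induct)
  case less
  show ?case
  proof (cases "J - T = {}")
    case True
    have "\<Phi> {} \<le> 0" using less.prems(3)[of "{}"] by simp
    also have "0 \<le> c * (real a powr (q / 2 - 1) * qpow_sum J q w)" using c by simp
    finally show ?thesis by (simp only: True)
  next
    case False
    have TJ: "T \<subseteq> J" using less.prems by (auto simp: top_set_def)
    have "T \<noteq> {}" using less.prems False a by (auto simp: top_set_def min_def split: if_splits)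
    then have lt: "card (J - T) < card J"
      using less.prems(1) TJ by (intro psubset_card_mono) auto
    obtain T' where T': "top_set (J - T) a w T'"
      using top_set_exists less.prems(1) by blast
    then have T'J: "T' \<subseteq> J - T" "card T' \<le> a" by (auto simp: top_set_def)
    have "\<Phi> (J - T) = \<Phi> (T' \<union> (J - T - T'))" using T'J by (auto intro: arg_cong[of _ _ \<Phi>])
    also have "\<dots> \<le> \<Phi> T' + \<Phi> (J - T - T')" using T'J by (intro less.prems(2)) auto
    also have "\<Phi> T' \<le> c * (\<Sum>i\<in>T'. (w i)\<^sup>2) powr (q / 2)" using T'J by (intro less.prems(3)) auto
    also have "\<dots> \<le> c * (real a powr (q / 2 - 1) * qpow_sum T q w)"
      using top_set_powr_le[OF less.prems(4,1) a T'J q] c by (intro mult_left_mono)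
    also have "\<Phi> (J - T - T') \<le> c * (real a powr (q / 2 - 1) * qpow_sum (J - T) q w)"
    proof (rule less.hyps[OF lt])
      show "\<Phi> (S \<union> T) \<le> \<Phi> S + \<Phi> T" if "S \<inter> T = {}" "S \<union> T \<subseteq> J - T''" for S T T''
        using that by (intro less.prems(2)) auto
      show "\<Phi> S \<le> c * (\<Sum>i\<in>S. (w i)\<^sup>2) powr (q / 2)" if "S \<subseteq> J - T" "card S \<le> a" for S
        using that by (intro less.prems(3)) auto
    qed (use less.prems T' in auto)
    also have "c * (real a powr (q / 2 - 1) * qpow_sum T q w)
        + c * (real a powr (q / 2 - 1) * qpow_sum (J - T) q w)
        = c * (real a powr (q / 2 - 1) * qpow_sum J q w)"
      by (simp add: qpow_sum_def algebra_simps
          sum.subset_diff[OF TJ less.prems(1), of "\<lambda>i. \<bar>w i\<bar> powr q"])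
    finally show ?thesis by simp
  qed
qed

text \<open>The peeling bound with \<open>c = 1\<close>, where subadditivity of
  \<open>\<Phi>\<close> is that of \<open>t powr (q / 2)\<close>. In \<open>error_estimate\<close>
  the same bound is used again with the measurements of the blocks as \<open>\<Phi>\<close>.\<close>

lemma top_set_tail_le:
  fixes q :: real
  assumes J: "finite J" and a: "0 < a" and q: "0 < q" "q \<le> 1" and T: "top_set J a w T"
  shows "(\<Sum>i\<in>J - T. (w i)\<^sup>2) powr (q / 2) \<le> real a powr (q / 2 - 1) * qpow_sum J q w"
proof -
  have "(\<Sum>i\<in>S \<union> T. (w i)\<^sup>2) powr (q / 2)
      \<le> (\<Sum>i\<in>S. (w i)\<^sup>2) powr (q / 2) + (\<Sum>i\<in>T. (w i)\<^sup>2) powr (q / 2)"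
    if "S \<inter> T = {}" "S \<union> T \<subseteq> J" for S T
    using that J q powr_add_le_add_powr[of "\<Sum>i\<in>S. (w i)\<^sup>2" "\<Sum>i\<in>T. (w i)\<^sup>2" "q / 2"]
    by (subst sum.union_disjoint) (auto simp: sum_nonneg intro: finite_subset)
  from top_set_remainder_le[OF J a q(1), of 1 "\<lambda>S. (\<Sum>i\<in>S. (w i)\<^sup>2) powr (q / 2)", OF _ this _ T]
  show ?thesis by simp
qed

section \<open>Tight frames and coherence\<close>

lemma coef_idx_finite [simp]: "finite (coef_idx \<iota> d)"
  by (simp add: coef_idx_def)

text \<open>The block vector \<open>\<Psi> v\<close>, whose k-th block is
  \<open>D\<^sub>k v\<^sub>k\<close>; summing its blocks gives \<open>Dbar v\<close>.\<close>

definition frame_part :: "(nat \<Rightarrow> nat) \<Rightarrow> (nat \<Rightarrow> nat \<Rightarrow> nat \<Rightarrow> real)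
    \<Rightarrow> (nat \<times> nat \<Rightarrow> real) \<Rightarrow> nat \<Rightarrow> nat \<Rightarrow> real" where
  "frame_part d D v k i = (\<Sum>j<d k. D k i j * v (k, j))"

lemma sum_coef_idx: "(\<Sum>p\<in>coef_idx \<iota> d. g p) = (\<Sum>k<\<iota>. \<Sum>j<d k. g (k, j))"
  by (simp add: coef_idx_def sum.Sigma)

lemma Dbar_mult_frame_part: "Dbar_mult \<iota> d D v i = (\<Sum>k<\<iota>. frame_part d D v k i)"
  by (simp add: Dbar_mult_def sum_coef_idx frame_part_def)

lemma Psi_adj_apply: "Psi_adj n D h (k, j) = (\<Sum>i<n. D k i j * h k i)"
  by (simp add: Psi_adj_def)

lemma Psi_adj_adjoint:
  "(\<Sum>k<\<iota>. \<Sum>i<n. frame_part d D v k i * h k i) = (\<Sum>p\<in>coef_idx \<iota> d. v p * Psi_adj n D h p)"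
  unfolding sum_coef_idx
proof (rule sum.cong[OF refl])
  fix k
  have "(\<Sum>i<n. frame_part d D v k i * h k i) = (\<Sum>i<n. \<Sum>j<d k. v (k, j) * (D k i j * h k i))"
    by (simp add: frame_part_def sum_distrib_left sum_distrib_right ac_simps)
  also have "\<dots> = (\<Sum>j<d k. \<Sum>i<n. v (k, j) * (D k i j * h k i))" by (rule sum.swap)
  finally show "(\<Sum>i<n. frame_part d D v k i * h k i) = (\<Sum>j<d k. v (k, j) * Psi_adj n D h (k, j))"
    by (simp add: Psi_adj_apply sum_distrib_left)
qed

lemma tight_frame1_sum_squares:
  assumes "tight_frame1 n dk Dk"
  shows "(\<Sum>j<dk. (\<Sum>i<n. Dk i j * g i)\<^sup>2) = (\<Sum>i<n. (g i)\<^sup>2)"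
proof -
  have "pnorm {..<dk} 2 (\<lambda>j. \<Sum>i<n. Dk i j * g i) powr 2 = pnorm {..<n} 2 g powr 2"
    using assms by (simp add: tight_frame1_def)
  then show ?thesis by (simp add: pnorm_powr) (simp add: qpow_sum_two)
qed

lemma Psi_adj_isometry:
  assumes "\<And>k. k < \<iota> \<Longrightarrow> tight_frame1 n (d k) (D k)"
  shows "(\<Sum>p\<in>coef_idx \<iota> d. (Psi_adj n D h p)\<^sup>2) = (\<Sum>k<\<iota>. \<Sum>i<n. (h k i)\<^sup>2)"
  unfolding sum_coef_idx Psi_adj_apply
  using assms by (intro sum.cong refl tight_frame1_sum_squares) auto

text \<open>The adjoint of an isometry is a contraction: Cauchy-Schwarz on the pairing of
  \<open>v\<close> with \<open>\<Psi>\<^sup>* \<Psi> v\<close> gives \<open>P^2 <= V * P\<close>,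
  and \<open>P\<close> cancels.\<close>

lemma frame_part_contraction:
  assumes "\<And>k. k < \<iota> \<Longrightarrow> tight_frame1 n (d k) (D k)"
  shows "(\<Sum>k<\<iota>. \<Sum>i<n. (frame_part d D v k i)\<^sup>2) \<le> (\<Sum>p\<in>coef_idx \<iota> d. (v p)\<^sup>2)"
proof -
  define P where "P = (\<Sum>k<\<iota>. \<Sum>i<n. (frame_part d D v k i)\<^sup>2)"
  define V where "V = (\<Sum>p\<in>coef_idx \<iota> d. (v p)\<^sup>2)"
  have "P = (\<Sum>p\<in>coef_idx \<iota> d. v p * Psi_adj n D (frame_part d D v) p)"
    using Psi_adj_adjoint[where h = "frame_part d D v"] by (simp add: P_def power2_eq_square)
  then have "P\<^sup>2 \<le> V * P"
    using Cauchy_Schwarz_ineq_sum[of v "Psi_adj n D (frame_part d D v)" "coef_idx \<iota> d"]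
    by (simp add: P_def V_def Psi_adj_isometry[OF assms])
  moreover have "0 \<le> P" "0 \<le> V" by (auto simp: P_def V_def sum_nonneg)
  ultimately show ?thesis
    unfolding P_def[symmetric] V_def[symmetric] by (cases "P = 0") (auto simp: power2_eq_square)
qed

text \<open>Polarization: the isometry is applied to \<open>g\<close>, to the i-th unit vector
  \<open>e\<close> and to their sum, so inner products are preserved too; the frame coefficients of
  \<open>e\<close> form row \<open>i\<close> of \<open>Dk\<close>.\<close>

lemma tight_frame1_reconstruct:
  assumes "tight_frame1 n dk Dk" "i < n"
  shows "(\<Sum>j<dk. Dk i j * (\<Sum>i'<n. Dk i' j * g i')) = g i"
proof -
  define e :: "nat \<Rightarrow> real" where "e = (\<lambda>i'. if i' = i then 1 else 0)"
  define \<alpha> where "\<alpha> = (\<lambda>g j. \<Sum>i'<n. Dk i' j * g i')"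
  have "c i' * e i' = (if i' = i then c i' else 0)" for c i'
    by (simp add: e_def)
  then have e: "(\<Sum>i'<n. c i' * e i') = c i" for c
    using assms(2) by simp
  have sq: "(\<Sum>j<dk. (\<alpha> g j)\<^sup>2) = (\<Sum>i'<n. (g i')\<^sup>2)" for g
    unfolding \<alpha>_def by (rule tight_frame1_sum_squares[OF assms(1)])
  have "(\<Sum>j<dk. (\<alpha> g j + \<alpha> e j)\<^sup>2) = (\<Sum>i'<n. (g i' + e i')\<^sup>2)"
    using sq[of "\<lambda>i. g i + e i"] by (simp add: \<alpha>_def distrib_left sum.distrib)
  then have "(\<Sum>j<dk. (\<alpha> g j)\<^sup>2) + (\<Sum>j<dk. (\<alpha> e j)\<^sup>2) + 2 * (\<Sum>j<dk. \<alpha> g j * \<alpha> e j)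
      = (\<Sum>i'<n. (g i')\<^sup>2) + (\<Sum>i'<n. (e i')\<^sup>2) + 2 * (\<Sum>i'<n. g i' * e i')"
    by (simp only: power2_sum sum.distrib sum_distrib_left mult.assoc)
  then have "(\<Sum>j<dk. \<alpha> g j * \<alpha> e j) = g i"
    unfolding sq e by simp
  moreover have "\<alpha> e j = Dk i j" for j
    unfolding \<alpha>_def by (rule e)
  ultimately show ?thesis by (simp add: \<alpha>_def mult.commute)
qed

lemma Dbar_mult_Psi_adj:
  assumes "\<And>k. k < \<iota> \<Longrightarrow> tight_frame1 n (d k) (D k)" "i < n"
  shows "Dbar_mult \<iota> d D (Psi_adj n D h) i = (\<Sum>k<\<iota>. h k i)"
  unfolding Dbar_mult_frame_part frame_part_def Psi_adj_apply
  using assms by (intro sum.cong refl tight_frame1_reconstruct) auto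

lemma mutual_coherence_bounds:
  shows mutual_coherence_nonneg: "0 \<le> mutual_coherence n \<iota> d D"
    and mutual_coherence_ge: "\<lbrakk>k < \<iota>; l < \<iota>; k \<noteq> l; b < d k; c < d l\<rbrakk>
      \<Longrightarrow> \<bar>\<Sum>i<n. D k i b * D l i c\<bar> \<le> mutual_coherence n \<iota> d D"
proof -
  define S where "S = {\<bar>\<Sum>i<n. D k i a * D l i b\<bar> | k l a b.
    k < \<iota> \<and> l < \<iota> \<and> k \<noteq> l \<and> a < d k \<and> b < d l}"
  have mc: "mutual_coherence n \<iota> d D = (if S = {} then 0 else Max S)"
    unfolding mutual_coherence_def S_def Let_def ..
  \<comment> \<open>\<open>Max\<close> is informative only on a finite set, so finiteness comes from
    pairs of coefficient indices.\<close>
  have "S \<subseteq> (\<lambda>(p, p'). \<bar>\<Sum>i<n. D (fst p) i (snd p) * D (fst p') i (snd p')\<bar>)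
      ` (coef_idx \<iota> d \<times> coef_idx \<iota> d)"
    by (fastforce simp: S_def coef_idx_def image_iff)
  then have fin: "finite S" by (rule finite_subset) auto
  show "0 \<le> mutual_coherence n \<iota> d D"
  proof (cases "S = {}")
    case False
    then have "Max S \<in> S" using fin by simp
    then have "0 \<le> Max S" by (auto simp: S_def)
    then show ?thesis by (simp add: mc)
  qed (simp add: mc)
  assume "k < \<iota>" "l < \<iota>" "k \<noteq> l" "b < d k" "c < d l"
  then have "\<bar>\<Sum>i<n. D k i b * D l i c\<bar> \<in> S" unfolding S_def by blast
  then show "\<bar>\<Sum>i<n. D k i b * D l i c\<bar> \<le> mutual_coherence n \<iota> d D"
    using fin by (auto simp: mc)
qed

lemma frame_part_inner_le:
  assumes "k < \<iota>" "l < \<iota>" "k \<noteq> l"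
  shows "\<bar>\<Sum>i<n. frame_part d D v k i * frame_part d D v l i\<bar>
    \<le> mutual_coherence n \<iota> d D * ((\<Sum>j<d k. \<bar>v (k, j)\<bar>) * (\<Sum>j<d l. \<bar>v (l, j)\<bar>))"
proof -
  have "(\<Sum>i<n. frame_part d D v k i * frame_part d D v l i)
      = (\<Sum>i<n. \<Sum>b<d k. \<Sum>c<d l. v (k, b) * v (l, c) * (D k i b * D l i c))"
    by (simp add: frame_part_def sum_product ac_simps)
  also have "\<dots> = (\<Sum>b<d k. \<Sum>i<n. \<Sum>c<d l. v (k, b) * v (l, c) * (D k i b * D l i c))"
    by (rule sum.swap)
  also have "\<dots> = (\<Sum>b<d k. \<Sum>c<d l. \<Sum>i<n. v (k, b) * v (l, c) * (D k i b * D l i c))"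
    by (intro sum.cong refl sum.swap)
  also have "\<dots> = (\<Sum>b<d k. \<Sum>c<d l. v (k, b) * v (l, c) * (\<Sum>i<n. D k i b * D l i c))"
    by (simp add: sum_distrib_left)
  finally have "\<bar>\<Sum>i<n. frame_part d D v k i * frame_part d D v l i\<bar>
      \<le> (\<Sum>b<d k. \<bar>\<Sum>c<d l. v (k, b) * v (l, c) * (\<Sum>i<n. D k i b * D l i c)\<bar>)"
    by (simp only: sum_abs)
  also have "\<dots> \<le> (\<Sum>b<d k. \<Sum>c<d l. \<bar>v (k, b)\<bar> * \<bar>v (l, c)\<bar> * \<bar>\<Sum>i<n. D k i b * D l i c\<bar>)"
  proof (rule sum_mono)
    fix b
    show "\<bar>\<Sum>c<d l. v (k, b) * v (l, c) * (\<Sum>i<n. D k i b * D l i c)\<bar>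
        \<le> (\<Sum>c<d l. \<bar>v (k, b)\<bar> * \<bar>v (l, c)\<bar> * \<bar>\<Sum>i<n. D k i b * D l i c\<bar>)"
      using sum_abs[of "\<lambda>c. v (k, b) * v (l, c) * (\<Sum>i<n. D k i b * D l i c)" "{..<d l}"]
      by (simp only: abs_mult)
  qed
  also have "\<dots> \<le> (\<Sum>b<d k. \<Sum>c<d l. \<bar>v (k, b)\<bar> * \<bar>v (l, c)\<bar> * mutual_coherence n \<iota> d D)"
    using assms by (intro sum_mono mult_left_mono mutual_coherence_ge) auto
  also have "\<dots> = mutual_coherence n \<iota> d D * ((\<Sum>j<d k. \<bar>v (k, j)\<bar>) * (\<Sum>j<d l. \<bar>v (l, j)\<bar>))"
    by (simp only: sum_product) (simp only: sum_distrib_left mult_ac)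
  finally show ?thesis .
qed

text \<open>Only the \<open>k \<noteq> l\<close> blocks contribute to the error, and Cauchy-Schwarz over the blocks then
  yields the factor \<open>1 - 1 / \<iota>\<close>. Without it the constants would depend on how far
  \<open>\<mu>\<^sub>1 (s + a) (\<rho>\<^bsup>2/q-1\<^esup> + 1)\<close> is from \<open>1\<close>.\<close>

lemma Dbar_mult_near_orthogonal:
  assumes \<iota>: "0 < \<iota>" and K: "card {p \<in> coef_idx \<iota> d. v p \<noteq> 0} \<le> K"
  shows "\<bar>(\<Sum>i<n. (Dbar_mult \<iota> d D v i)\<^sup>2) - (\<Sum>k<\<iota>. \<Sum>i<n. (frame_part d D v k i)\<^sup>2)\<bar>
    \<le> (1 - 1 / real \<iota>) * (mutual_coherence n \<iota> d D * real K * (\<Sum>p\<in>coef_idx \<iota> d. (v p)\<^sup>2))"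
proof -
  define \<mu> where "\<mu> = mutual_coherence n \<iota> d D"
  have \<mu>: "0 \<le> \<mu>" by (simp add: \<mu>_def mutual_coherence_nonneg)
  define g where "g = frame_part d D v"
  define N where "N k = (\<Sum>j<d k. \<bar>v (k, j)\<bar>)" for k
  define c where "c k l = (\<Sum>i<n. g k i * g l i)" for k l
  have split: "(\<Sum>l<\<iota>. h l) = h k + (\<Sum>l\<in>{..<\<iota>} - {k}. h l)" if "k < \<iota>" for h :: "nat \<Rightarrow> real" and k
    using that by (intro sum.remove) auto
  have "(\<Sum>i<n. (Dbar_mult \<iota> d D v i)\<^sup>2) = (\<Sum>i<n. \<Sum>k<\<iota>. \<Sum>l<\<iota>. g k i * g l i)"
    by (simp add: Dbar_mult_frame_part g_def power2_eq_square sum_product)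
  also have "\<dots> = (\<Sum>k<\<iota>. \<Sum>i<n. \<Sum>l<\<iota>. g k i * g l i)" by (rule sum.swap)
  also have "\<dots> = (\<Sum>k<\<iota>. \<Sum>l<\<iota>. c k l)"
    unfolding c_def by (intro sum.cong refl sum.swap)
  also have "\<dots> = (\<Sum>k<\<iota>. c k k + (\<Sum>l\<in>{..<\<iota>} - {k}. c k l))"
    by (intro sum.cong refl split) auto
  also have "\<dots> = (\<Sum>k<\<iota>. \<Sum>i<n. (g k i)\<^sup>2) + (\<Sum>k<\<iota>. \<Sum>l\<in>{..<\<iota>} - {k}. c k l)"
    by (simp add: sum.distrib c_def power2_eq_square)
  finally have "\<bar>(\<Sum>i<n. (Dbar_mult \<iota> d D v i)\<^sup>2) - (\<Sum>k<\<iota>. \<Sum>i<n. (g k i)\<^sup>2)\<bar>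
      = \<bar>\<Sum>k<\<iota>. \<Sum>l\<in>{..<\<iota>} - {k}. c k l\<bar>" by simp
  also have "\<dots> \<le> (\<Sum>k<\<iota>. \<Sum>l\<in>{..<\<iota>} - {k}. \<bar>c k l\<bar>)"
    by (rule order.trans[OF sum_abs sum_mono]) (rule sum_abs)
  also have "\<dots> \<le> (\<Sum>k<\<iota>. \<Sum>l\<in>{..<\<iota>} - {k}. \<mu> * (N k * N l))"
    unfolding c_def g_def \<mu>_def N_def by (intro sum_mono frame_part_inner_le) auto
  \<comment> \<open>Restoring the diagonal turns the double sum into the square of the sum of the
    \<open>N k\<close>, minus the sum of their squares.\<close>
  also have "\<dots> = (\<Sum>k<\<iota>. (\<Sum>l<\<iota>. \<mu> * (N k * N l)) - \<mu> * (N k * N k))"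
    by (intro sum.cong refl) (simp add: split[of _ "\<lambda>l. \<mu> * (N _ * N l)"])
  also have "\<dots> = \<mu> * ((\<Sum>k<\<iota>. N k)\<^sup>2 - (\<Sum>k<\<iota>. (N k)\<^sup>2))"
    by (simp only: power2_eq_square sum_subtractf sum_product right_diff_distrib)
      (simp only: sum_distrib_left)
  also have "\<dots> \<le> \<mu> * ((1 - 1 / real \<iota>) * (\<Sum>k<\<iota>. N k)\<^sup>2)"
  proof (intro mult_left_mono \<mu>)
    have "(\<Sum>k<\<iota>. N k)\<^sup>2 \<le> (\<Sum>k<\<iota>. (N k)\<^sup>2) * real \<iota>"
      using sum_squared_le_sum_of_squares[of N "{..<\<iota>}"] by simp
    then show "(\<Sum>k<\<iota>. N k)\<^sup>2 - (\<Sum>k<\<iota>. (N k)\<^sup>2) \<le> (1 - 1 / real \<iota>) * (\<Sum>k<\<iota>. N k)\<^sup>2"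
      using \<iota> by (simp add: field_simps)
  qed
  also have "\<dots> \<le> \<mu> * ((1 - 1 / real \<iota>) * (real K * (\<Sum>p\<in>coef_idx \<iota> d. (v p)\<^sup>2)))"
  proof -
    \<comment> \<open>Sparsity enters here: Cauchy-Schwarz is taken over the support of
      \<open>v\<close> only.\<close>
    have "(\<Sum>k<\<iota>. N k)\<^sup>2 \<le> real K * (\<Sum>p\<in>coef_idx \<iota> d. (v p)\<^sup>2)"
    proof -
      let ?S = "{p \<in> coef_idx \<iota> d. v p \<noteq> 0}"
      have "(\<Sum>k<\<iota>. N k) = (\<Sum>p\<in>coef_idx \<iota> d. \<bar>v p\<bar>)"
        by (simp add: sum_coef_idx N_def)
      also have "\<dots> = (\<Sum>p\<in>?S. \<bar>v p\<bar>)" by (intro sum.mono_neutral_right) auto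
      finally have "(\<Sum>k<\<iota>. N k)\<^sup>2 \<le> (\<Sum>p\<in>?S. (v p)\<^sup>2) * real (card ?S)"
        using sum_squared_le_sum_of_squares[of "\<lambda>p. \<bar>v p\<bar>" ?S] by simp
      also have "(\<Sum>p\<in>?S. (v p)\<^sup>2) = (\<Sum>p\<in>coef_idx \<iota> d. (v p)\<^sup>2)"
        by (intro sum.mono_neutral_left) auto
      also have "\<dots> * real (card ?S) \<le> \<dots> * real K"
        using K by (intro mult_left_mono) (auto simp: sum_nonneg)
      finally show ?thesis by (simp add: mult.commute)
    qed
    then show ?thesis using \<mu> \<iota> by (intro mult_left_mono) auto
  qed
  finally show ?thesis
    by (simp only: g_def \<mu>_def mult.assoc mult.left_commute)
qed

section \<open>Attainment of the restricted isometry constants\<close>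

text \<open>For each fixed \<open>v\<close> the two inequalities are closed conditions on \<delta>,
  so they survive passage to the infimum. An admissible \<delta> below 1 is assumed because the
  infimum of the empty set carries no information.\<close>

lemma rip_const_rip_holds:
  assumes "\<exists>\<delta>. 0 \<le> \<delta> \<and> \<delta> < 1 \<and> rip_holds m n \<iota> d D A q k \<delta>"
  shows rip_const_nonneg: "0 \<le> rip_const m n \<iota> d D A q k"
    and rip_const_less_1: "rip_const m n \<iota> d D A q k < 1"
    and rip_holds_rip_const: "rip_holds m n \<iota> d D A q k (rip_const m n \<iota> d D A q k)"
proof -
  define S where "S = {\<delta>. 0 \<le> \<delta> \<and> \<delta> < 1 \<and> rip_holds m n \<iota> d D A q k \<delta>}"
  obtain \<delta>0 where \<delta>0: "\<delta>0 \<in> S" using assms by (auto simp: S_def)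
  have c: "rip_const m n \<iota> d D A q k = Inf S" by (simp add: rip_const_def S_def)
  have bdd: "bdd_below S" by (auto simp: S_def)
  show "0 \<le> rip_const m n \<iota> d D A q k"
    unfolding c using \<delta>0 by (intro cInf_greatest) (auto simp: S_def)
  have "Inf S \<le> \<delta>0" by (rule cInf_lower[OF \<delta>0 bdd])
  then show "rip_const m n \<iota> d D A q k < 1" using \<delta>0 by (simp add: c S_def)
  show "rip_holds m n \<iota> d D A q k (rip_const m n \<iota> d D A q k)"
    unfolding rip_holds_def
  proof (intro allI impI)
    fix v :: "nat \<times> nat \<Rightarrow> real" assume v: "card {p \<in> coef_idx \<iota> d. v p \<noteq> 0} \<le> k"
    define X where "X = pnorm {..<n} 2 (Dbar_mult \<iota> d D v) powr q"
    define Y where "Y = qpow_sum {..<m} q (matvec n A (Dbar_mult \<iota> d D v))"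
    have XY: "(1 - \<delta>) * X \<le> Y" "Y \<le> (1 + \<delta>) * X" if "\<delta> \<in> S" for \<delta>
      using that v by (auto simp: S_def rip_holds_def X_def Y_def)
    have "(1 - Inf S) * X \<le> Y \<and> Y \<le> (1 + Inf S) * X"
    proof (cases "X = 0")
      case True
      then show ?thesis using XY[OF \<delta>0] by simp
    next
      case False
      then have X: "X > 0" by (simp add: X_def)
      \<comment> \<open>Divided by \<open>X\<close>, both inequalities become lower bounds for
        \<delta>, which the infimum inherits.\<close>
      have "1 - Y / X \<le> \<delta>" "Y / X - 1 \<le> \<delta>" if "\<delta> \<in> S" for \<delta>
        using XY[OF that] X by (simp_all add: field_simps)
      then have "1 - Y / X \<le> Inf S" "Y / X - 1 \<le> Inf S"
        using \<delta>0 by (auto intro!: cInf_greatest)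
      then show ?thesis using X by (simp add: field_simps)
    qed
    then show "(1 - rip_const m n \<iota> d D A q k) * pnorm {..<n} 2 (Dbar_mult \<iota> d D v) powr q
        \<le> qpow_sum {..<m} q (matvec n A (Dbar_mult \<iota> d D v)) \<and>
      qpow_sum {..<m} q (matvec n A (Dbar_mult \<iota> d D v))
        \<le> (1 + rip_const m n \<iota> d D A q k) * pnorm {..<n} 2 (Dbar_mult \<iota> d D v) powr q"
      by (simp add: X_def Y_def c)
  qed
qed

section \<open>Slack in the hypotheses and the choice of \<theta>\<close>

text \<open>A lower bound for \<open>\<parallel>Dbar u\<parallel>\<^sup>2 /
  \<parallel>u\<parallel>\<^sup>2\<close> when \<open>e\<close> is at most \<theta> times
  \<open>\<parallel>u\<parallel>\<^sup>q\<close>: the first fraction bounds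
  \<open>\<parallel>\<Psi> u\<parallel>\<^sup>2\<close> from below, the second is the loss due to
  coherence.\<close>

definition frame_gap :: "real \<Rightarrow> nat \<Rightarrow> real \<Rightarrow> real \<Rightarrow> real" where
  "frame_gap \<rho> \<iota> q \<theta> = 1 / (1 + (\<rho> powr (1 - q / 2) + \<theta>) powr (2 / q))
     - (1 - 1 / real \<iota>) / (1 + \<rho> powr (2 / q - 1))"

text \<open>The net coefficient of \<open>\<parallel>u\<parallel>\<^sup>q\<close> once the upper RIP
  bound for the blocks off \<open>T\<close> is subtracted from the lower RIP bound for
  \<open>u\<close>. If it is positive, the measurement controls \<open>u\<close>.\<close>

definition recovery_margin :: "real \<Rightarrow> real \<Rightarrow> real \<Rightarrow> nat \<Rightarrow> real \<Rightarrow> real \<Rightarrow> real" where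
  "recovery_margin \<delta>a \<delta>sa \<rho> \<iota> q \<theta> = (1 - \<delta>sa) * frame_gap \<rho> \<iota> q \<theta> powr (q / 2)
     - (1 + \<delta>a) * 2 powr (q / 2) * (\<rho> powr (1 - q / 2) + \<theta>)"

text \<open>At \<theta> = 0 the two fractions of \<open>frame_gap\<close> share a denominator and
  leave \<open>1 / (\<iota> * (1 + \<kappa>))\<close>, so that \<open>cond\<close> says exactly that
  the margin is positive. Continuity preserves both strict inequalities for small positive
  \<theta>.\<close>

lemma recovery_margin_pos:
  assumes q: "0 < q" "q \<le> 1" and \<rho>: "0 < \<rho>" and \<iota>: "0 < \<iota>" and \<delta>sa: "\<delta>sa < 1"
    and cond: "(1 + \<delta>a) / (1 - \<delta>sa) * \<rho> powr (1 - q / 2) * (\<rho> powr (2 / q - 1) + 1) powr (q / 2)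
      < (2 * real \<iota>) powr (- q / 2)"
  shows "\<exists>\<theta>>0. 0 < frame_gap \<rho> \<iota> q \<theta> \<and> 0 < recovery_margin \<delta>a \<delta>sa \<rho> \<iota> q \<theta>"
proof -
  define \<kappa> where "\<kappa> = \<rho> powr (2 / q - 1)"
  have \<kappa>: "0 < \<kappa>" using \<rho> by (simp add: \<kappa>_def)
  have "(\<rho> powr (1 - q / 2)) powr (2 / q) = \<kappa>"
    using q by (simp add: powr_powr \<kappa>_def algebra_simps diff_divide_distrib)
  then have g0: "frame_gap \<rho> \<iota> q 0 = 1 / (real \<iota> * (1 + \<kappa>))"
    by (simp add: frame_gap_def diff_divide_distrib flip: \<kappa>_def)
  have g0pos: "0 < frame_gap \<rho> \<iota> q 0" using \<kappa> \<iota> by (simp add: g0)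
  have Q: "frame_gap \<rho> \<iota> q 0 powr (q / 2) = 1 / (real \<iota> powr (q / 2) * (1 + \<kappa>) powr (q / 2))"
    by (simp add: g0 powr_divide powr_mult)
  have P: "(2 * real \<iota>) powr (- q / 2) = 1 / (2 powr (q / 2) * real \<iota> powr (q / 2))"
    using \<iota> by (simp add: powr_minus_divide powr_mult)
  have "(1 + \<delta>a) / (1 - \<delta>sa) * \<rho> powr (1 - q / 2) * (1 + \<kappa>) powr (q / 2)
      < 1 / (2 powr (q / 2) * real \<iota> powr (q / 2))"
    using cond unfolding P \<kappa>_def by (simp only: add.commute)
  then have "(1 + \<delta>a) * \<rho> powr (1 - q / 2) * (1 + \<kappa>) powr (q / 2) * (2 powr (q / 2) * real \<iota> powr (q / 2))
      < 1 - \<delta>sa"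
    using \<delta>sa \<iota> by (simp add: pos_less_divide_eq pos_divide_less_eq)
  then have "(1 + \<delta>a) * 2 powr (q / 2) * \<rho> powr (1 - q / 2) < (1 - \<delta>sa) * frame_gap \<rho> \<iota> q 0 powr (q / 2)"
    unfolding Q using \<kappa> \<iota> by (simp add: pos_less_divide_eq ac_simps)
  then have m0pos: "0 < recovery_margin \<delta>a \<delta>sa \<rho> \<iota> q 0"
    by (simp add: recovery_margin_def)
  have base: "1 + (\<rho> powr (1 - q / 2)) powr (2 / q) \<noteq> 0"
    using powr_ge_zero[of "\<rho> powr (1 - q / 2)" "2 / q"] by linarith
  have "isCont (frame_gap \<rho> \<iota> q) 0"
    unfolding frame_gap_def using \<rho> base by (intro continuous_intros) auto
  then have g: "(frame_gap \<rho> \<iota> q \<longlongrightarrow> frame_gap \<rho> \<iota> q 0) (at_right 0)"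
    by (simp add: isCont_def filterlim_at_split)
  have "(recovery_margin \<delta>a \<delta>sa \<rho> \<iota> q \<longlongrightarrow> recovery_margin \<delta>a \<delta>sa \<rho> \<iota> q 0) (at_right 0)"
    unfolding recovery_margin_def using g g0pos by (intro tendsto_intros) auto
  with g g0pos m0pos have "eventually (\<lambda>\<theta>. 0 < frame_gap \<rho> \<iota> q \<theta>) (at_right 0)"
    "eventually (\<lambda>\<theta>. 0 < recovery_margin \<delta>a \<delta>sa \<rho> \<iota> q \<theta>) (at_right 0)"
    by (auto simp: order_tendsto_iff)
  moreover have "eventually (\<lambda>\<theta>::real. 0 < \<theta>) (at_right 0)"
    by (simp add: eventually_at_right_less)
  ultimately have "eventually (\<lambda>\<theta>. 0 < \<theta> \<and> 0 < frame_gap \<rho> \<iota> q \<theta>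
      \<and> 0 < recovery_margin \<delta>a \<delta>sa \<rho> \<iota> q \<theta>) (at_right 0)"
    by (auto elim: eventually_elim2 intro: eventually_conj)
  from eventually_happens'[OF _ this] show ?thesis by (auto simp: trivial_limit_at_right_real)
qed

section \<open>The error estimate for a vector in the cone\<close>

text \<open>The sign \<open>c\<close> covers two uses: \<open>1\<close> joins disjoint blocks, and
  \<open>-1\<close> writes the head as \<open>w\<close> minus the rest.\<close>

lemma measurement_subadditive:
  assumes q: "0 \<le> q" "q \<le> 1" and c: "\<bar>c\<bar> = 1"
    and u: "\<And>p. p \<in> coef_idx \<iota> d \<Longrightarrow> u p = v p + c * v' p"
  shows "qpow_sum {..<m} q (matvec n A (Dbar_mult \<iota> d D u))
    \<le> qpow_sum {..<m} q (matvec n A (Dbar_mult \<iota> d D v))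
      + qpow_sum {..<m} q (matvec n A (Dbar_mult \<iota> d D v'))"
proof -
  have "Dbar_mult \<iota> d D u i = Dbar_mult \<iota> d D v i + c * Dbar_mult \<iota> d D v' i" for i
    by (simp add: Dbar_mult_def u algebra_simps sum.distrib sum_distrib_left)
  then have "matvec n A (Dbar_mult \<iota> d D u)
      = (\<lambda>i. matvec n A (Dbar_mult \<iota> d D v) i + c * matvec n A (Dbar_mult \<iota> d D v') i)"
    by (simp add: matvec_def algebra_simps sum.distrib sum_distrib_left)
  then have "qpow_sum {..<m} q (matvec n A (Dbar_mult \<iota> d D u))
    \<le> qpow_sum {..<m} q (matvec n A (Dbar_mult \<iota> d D v))
      + qpow_sum {..<m} q (\<lambda>i. c * matvec n A (Dbar_mult \<iota> d D v') i)"
    using qpow_sum_add_le[OF q] by simp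
  then show ?thesis using c by (simp add: qpow_sum_def abs_mult)
qed

text \<open>\<open>X\<close> is \<open>\<parallel>u\<parallel>\<^sup>q\<close>, the one quantity
  behind both bounds of the theorem: the first conclusion serves the coefficient bound, the third
  the Euclidean one. In the application \<open>\<tau>\<close> is twice the q-sum of the tail of
  \<open>\<Psi>\<^sup>* f\<close>, and \<open>e\<close> rescales it to be comparable with
  \<open>X\<close>.\<close>

lemma error_estimate:
  assumes \<iota>: "0 < \<iota>" and q: "0 < q" "q \<le> 1" and s: "0 < s" and sa: "s < a"
    and frames: "\<And>k. k < \<iota> \<Longrightarrow> tight_frame1 n (d k) (D k)"
    and rip_a: "rip_holds m n \<iota> d D A q a \<delta>a" and \<delta>a: "0 \<le> \<delta>a"
    and rip_sa: "rip_holds m n \<iota> d D A q (s + a) \<delta>sa" and \<delta>sa: "\<delta>sa < 1"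
    and \<rho>: "\<rho> = real s / real a"
    and coh: "mutual_coherence n \<iota> d D * real (s + a) * (\<rho> powr (2 / q - 1) + 1) < 1"
    and \<theta>: "0 < \<theta>" and gap: "0 < frame_gap \<rho> \<iota> q \<theta>"
    and L: "L = recovery_margin \<delta>a \<delta>sa \<rho> \<iota> q \<theta>" "0 < L"
    and w: "w = Psi_adj n D h" and I: "I = coef_idx \<iota> d"
    and T0: "T0 \<subseteq> I" "card T0 \<le> s" and \<tau>: "0 \<le> \<tau>"
    and cone: "qpow_sum (I - T0) q w \<le> qpow_sum T0 q w + \<tau>"
    and meas: "qpow_sum {..<m} q (matvec n A (Dbar_mult \<iota> d D w)) \<le> M"
    and e: "e = \<tau> * real a powr (q / 2 - 1)"
  obtains X where "qpow_sum T0 q w \<le> real s powr (1 - q / 2) * X"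
    and "X \<le> M / L + e / \<theta>"
    and "(\<Sum>p\<in>I. (w p)\<^sup>2) powr (q / 2) \<le> 2 * X + e"
proof -
  define J where "J = I - T0"
  have fin: "finite I" "finite J" "finite T0" using T0 by (auto simp: I J_def intro: finite_subset)
  have a: "0 < a" using sa by simp
  obtain T1 where T1: "top_set J a w T1" using top_set_exists fin by blast
  then have T1J: "T1 \<subseteq> J" "card T1 \<le> a" by (auto simp: top_set_def)
  have finT1: "finite T1" using T1J fin finite_subset by blast
  define T where "T = T0 \<union> T1"
  have TI: "T \<subseteq> I" and cT: "card T \<le> s + a" and finT: "finite T" and JT1: "J - T1 = I - T"
    using T0 T1J card_Un_le[of T0 T1] finT1 fin by (auto simp: T_def J_def)
  define rst where "rst S p = (if p \<in> S then w p else 0)" for S p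
  define \<Phi> where "\<Phi> S = qpow_sum {..<m} q (matvec n A (Dbar_mult \<iota> d D (rst S)))" for S
  define N where "N v = (\<Sum>i<n. (Dbar_mult \<iota> d D v i)\<^sup>2)" for v
  define P where "P v = (\<Sum>k<\<iota>. \<Sum>i<n. (frame_part d D v k i)\<^sup>2)" for v
  define \<mu> where "\<mu> = mutual_coherence n \<iota> d D"
  define \<kappa> where "\<kappa> = \<rho> powr (2 / q - 1)"
  have \<kappa>: "0 \<le> \<kappa>" by (simp add: \<kappa>_def)
  have \<mu>: "0 \<le> \<mu>" by (simp add: \<mu>_def mutual_coherence_nonneg)
  have "\<mu> * real (s + a) * (1 + \<kappa>) \<le> 1"
    using coh unfolding \<mu>_def \<kappa>_def by (simp add: add.commute)
  moreover have "0 < 1 + \<kappa>" using \<kappa> by simp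
  ultimately have \<mu>sa: "\<mu> * real (s + a) \<le> 1 / (1 + \<kappa>)"
    by (simp only: pos_le_divide_eq)
  have "\<mu> * real a \<le> \<mu> * real (s + a)" using \<mu> by (intro mult_left_mono) auto
  also have "\<dots> \<le> 1" using \<kappa> by (intro order.trans[OF \<mu>sa]) (simp add: field_simps)
  finally have \<mu>a: "\<mu> * real a \<le> 1" .
  have frac: "0 \<le> 1 - 1 / real \<iota>" "1 - 1 / real \<iota> \<le> 1" using \<iota> by (auto simp: field_simps)
  have sq_rst: "(\<Sum>p\<in>I. (rst S p)\<^sup>2) = (\<Sum>p\<in>S. (w p)\<^sup>2)" if "S \<subseteq> I" for S
    using that fin by (intro sum.mono_neutral_cong_right) (auto simp: rst_def)
  have supp: "card {p \<in> I. rst S p \<noteq> 0} \<le> card S" if "S \<subseteq> I" for S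
    using that fin by (intro card_mono) (auto simp: rst_def intro: finite_subset split: if_splits)
  have near: "\<bar>N (rst S) - P (rst S)\<bar> \<le> (1 - 1 / real \<iota>) * (\<mu> * real K * (\<Sum>p\<in>S. (w p)\<^sup>2))"
    if "S \<subseteq> I" "card S \<le> K" for S K
    using Dbar_mult_near_orthogonal[OF \<iota>, where v = "rst S" and K = K and n = n and d = d and D = D] supp[OF that(1)] sq_rst[OF that(1)] that
    by (simp add: N_def P_def \<mu>_def I)
  have sub: "\<Phi> (S \<union> S') \<le> \<Phi> S + \<Phi> S'" if "S \<inter> S' = {}" for S S'
    unfolding \<Phi>_def using q that by (intro measurement_subadditive[where c = 1]) (auto simp: rst_def)
  \<comment> \<open>The factor 2 under the power: \<open>\<Psi>\<close> is a contraction, and since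
    \<open>\<mu> * real a\<close> is at most 1 the cross terms add at most the same amount once
    more.\<close>
  have bd: "\<Phi> S \<le> (1 + \<delta>a) * 2 powr (q / 2) * (\<Sum>p\<in>S. (w p)\<^sup>2) powr (q / 2)"
    if S: "S \<subseteq> J" "card S \<le> a" for S
  proof -
    have SI: "S \<subseteq> I" using S by (auto simp: J_def)
    let ?V = "\<Sum>p\<in>S. (w p)\<^sup>2"
    have V: "0 \<le> ?V" by (simp add: sum_nonneg)
    have "P (rst S) \<le> ?V"
      using frame_part_contraction[where \<iota> = \<iota> and d = d and D = D and n = n and v = "rst S", OF frames] sq_rst[OF SI] by (simp add: P_def I)
    moreover have "(1 - 1 / real \<iota>) * (\<mu> * real a * ?V) \<le> 1 * (1 * ?V)"
      using frac \<mu>a \<mu> V by (intro mult_mono) auto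
    ultimately have "N (rst S) \<le> 2 * ?V" using near[OF SI S(2)] by linarith
    then have "N (rst S) powr (q / 2) \<le> (2 * ?V) powr (q / 2)"
      using q by (intro powr_mono2) (auto simp: N_def sum_nonneg)
    moreover have "\<Phi> S \<le> (1 + \<delta>a) * N (rst S) powr (q / 2)"
      using rip_a order.trans[OF supp[OF SI] S(2)]
      by (simp add: rip_holds_def \<Phi>_def N_def pnorm_two_powr I)
    moreover have "(1 + \<delta>a) * N (rst S) powr (q / 2) \<le> (1 + \<delta>a) * (2 * ?V) powr (q / 2)"
      using calculation(1) \<delta>a by (intro mult_left_mono) auto
    ultimately show ?thesis by (simp add: powr_mult mult.assoc)
  qed
  define U where "U = (\<Sum>p\<in>T. (w p)\<^sup>2)"
  define R where "R = (\<Sum>p\<in>J - T1. (w p)\<^sup>2)"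
  define W where "W = (\<Sum>p\<in>I. (w p)\<^sup>2)"
  define X where "X = U powr (q / 2)"
  have nn: "0 \<le> U" "0 \<le> R" "0 \<le> X" "0 \<le> e" "0 \<le> W"
    using \<tau> by (auto simp: U_def R_def X_def W_def e sum_nonneg)
  have WUR: "W = U + R"
    using sum.subset_diff[OF TI fin(1), of "\<lambda>p. (w p)\<^sup>2"] by (simp add: W_def U_def R_def JT1)
  have headX: "qpow_sum T0 q w \<le> real s powr (1 - q / 2) * X"
  proof -
    have "qpow_sum T0 q w \<le> real (card T0) powr (1 - q / 2) * (\<Sum>p\<in>T0. (w p)\<^sup>2) powr (q / 2)"
      using powr_card_sum_le[of T0 "\<lambda>p. \<bar>w p\<bar>" q 2] fin q
      by (simp add: qpow_sum_def powr_numeral)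
    also have "\<dots> \<le> real s powr (1 - q / 2) * U powr (q / 2)"
      unfolding U_def using T0 q finT
      by (intro mult_mono powr_mono2 sum_mono2) (auto simp: T_def sum_nonneg)
    finally show ?thesis by (simp add: X_def)
  qed
  have \<rho>s: "real a powr (q / 2 - 1) * real s powr (1 - q / 2) = \<rho> powr (1 - q / 2)"
  proof -
    have "real a powr (q / 2 - 1) = 1 / real a powr (1 - q / 2)"
      using powr_minus_divide[of "real a" "1 - q / 2"] by simp
    then show ?thesis by (simp add: \<rho> powr_divide)
  qed
  \<comment> \<open>The cone condition trades the q-sum off \<open>T0\<close> for the one on
    \<open>T0\<close>, which has at most \<open>s\<close> entries; the mismatch between
    \<open>s\<close> and \<open>a\<close> is the power of \<rho>.\<close>
  have tailJ: "real a powr (q / 2 - 1) * qpow_sum J q w \<le> \<rho> powr (1 - q / 2) * X + e"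
  proof -
    have "real a powr (q / 2 - 1) * qpow_sum J q w
        \<le> real a powr (q / 2 - 1) * (real s powr (1 - q / 2) * X + \<tau>)"
      using cone headX by (intro mult_left_mono) (auto simp: J_def)
    then show ?thesis by (simp add: e \<rho>s[symmetric] algebra_simps)
  qed
  have RX: "R powr (q / 2) \<le> \<rho> powr (1 - q / 2) * X + e"
    unfolding R_def by (rule order.trans[OF top_set_tail_le[OF fin(2) a q T1] tailJ])
  have M: "0 \<le> M" using order.trans[OF qpow_sum_nonneg meas] .
  have "X \<le> M / L + e / \<theta>"
  \<comment> \<open>Either the tail already dominates \<open>X\<close>, or \<open>e\<close> can be
    absorbed into \<open>X\<close> at the cost of raising the factor
    \<open>\<rho> powr (1 - q / 2)\<close> by \<theta>.\<close>
  proof (cases "X \<le> e / \<theta>")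
    case True
    then show ?thesis using M L by (simp add: add_increasing)
  next
    case False
    then have eX: "e \<le> \<theta> * X" using \<theta> by (simp add: field_simps)
    have "0 < X" using False nn \<theta> by (smt (verit) divide_nonneg_pos)
    then have U: "0 < U" using nn by (cases "U = 0") (auto simp: X_def)
    define c where "c = \<rho> powr (1 - q / 2) + \<theta>"
    have c: "0 < c" using \<theta> by (simp add: c_def add_nonneg_pos)
    have cX: "\<rho> powr (1 - q / 2) * X + e \<le> c * X" using eX by (simp add: c_def algebra_simps)
    have "(R powr (q / 2)) powr (2 / q) \<le> (c * X) powr (2 / q)"
      using RX cX q by (intro powr_mono2) auto
    then have "R \<le> c powr (2 / q) * U"
      using q nn by (simp add: powr_powr powr_mult X_def)
    then have W: "W \<le> (1 + c powr (2 / q)) * U" by (simp add: WUR algebra_simps)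
    \<comment> \<open>\<open>\<Psi>\<close> need not be bounded below on arbitrary coefficients, but
      \<open>w\<close> lies in the range of its adjoint. Hence \<open>U\<close> is the pairing of
      \<open>\<Psi> u\<close> with \<open>h\<close>, and Cauchy-Schwarz with the bound on
      \<open>W\<close> bounds \<open>P (rst T)\<close> from below.\<close>
    have "U = (\<Sum>p\<in>I. rst T p * w p)"
      unfolding U_def using TI fin
      by (intro sum.mono_neutral_cong_left) (auto simp: rst_def power2_eq_square)
    also have "\<dots> = (\<Sum>k<\<iota>. \<Sum>i<n. frame_part d D (rst T) k i * h k i)"
      by (simp add: Psi_adj_adjoint w I)
    also have "\<dots> = (\<Sum>p\<in>{..<\<iota>} \<times> {..<n}. frame_part d D (rst T) (fst p) (snd p) * h (fst p) (snd p))"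
      by (simp add: sum.cartesian_product case_prod_unfold)
    finally have "U\<^sup>2 \<le> (\<Sum>p\<in>{..<\<iota>} \<times> {..<n}. (frame_part d D (rst T) (fst p) (snd p))\<^sup>2)
        * (\<Sum>p\<in>{..<\<iota>} \<times> {..<n}. (h (fst p) (snd p))\<^sup>2)"
      by (simp only: Cauchy_Schwarz_ineq_sum)
    also have "\<dots> = P (rst T) * W"
      using Psi_adj_isometry[where \<iota> = \<iota> and d = d and D = D and n = n, OF frames]
      by (simp add: P_def W_def I w sum.cartesian_product case_prod_unfold)
    also have "\<dots> \<le> P (rst T) * ((1 + c powr (2 / q)) * U)"
      using W by (intro mult_left_mono) (auto simp: P_def sum_nonneg)
    finally have "U * U \<le> (P (rst T) * (1 + c powr (2 / q))) * U"
      by (simp add: power2_eq_square ac_simps)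
    then have "U \<le> P (rst T) * (1 + c powr (2 / q))" using U by simp
    moreover have "0 < 1 + c powr (2 / q)" by (simp add: add_pos_nonneg)
    ultimately have P: "U / (1 + c powr (2 / q)) \<le> P (rst T)" by (simp add: pos_divide_le_eq)
    have "(1 - 1 / real \<iota>) * (\<mu> * real (s + a) * U) \<le> (1 - 1 / real \<iota>) * (1 / (1 + \<kappa>) * U)"
      using frac \<mu>sa nn by (intro mult_left_mono mult_right_mono)
    then have "U / (1 + c powr (2 / q)) - (1 - 1 / real \<iota>) * (1 / (1 + \<kappa>) * U) \<le> N (rst T)"
      using near[OF TI cT] P unfolding U_def[symmetric] by linarith
    then have "frame_gap \<rho> \<iota> q \<theta> * U \<le> N (rst T)"
      by (simp add: frame_gap_def c_def \<kappa>_def left_diff_distrib)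
    then have "(frame_gap \<rho> \<iota> q \<theta> * U) powr (q / 2) \<le> N (rst T) powr (q / 2)"
      using gap nn q by (intro powr_mono2) auto
    then have "(1 - \<delta>sa) * (frame_gap \<rho> \<iota> q \<theta> powr (q / 2) * X) \<le> (1 - \<delta>sa) * N (rst T) powr (q / 2)"
      using \<delta>sa by (intro mult_left_mono) (auto simp: powr_mult X_def)
    also have "\<dots> \<le> \<Phi> T"
      using rip_sa order.trans[OF supp[OF TI] cT]
      by (simp add: rip_holds_def \<Phi>_def N_def pnorm_two_powr I)
    \<comment> \<open>The head is \<open>w\<close> minus its part off \<open>T\<close>. The
      measurement of \<open>w\<close> is at most \<open>M\<close>, and the rest is peeled into
      blocks of at most \<open>a\<close> entries, to which \<open>bd\<close> applies.\<close>
    also have "\<dots> \<le> qpow_sum {..<m} q (matvec n A (Dbar_mult \<iota> d D w)) + \<Phi> (J - T1)"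
      unfolding \<Phi>_def using q TI
      by (intro measurement_subadditive[where c = "-1"]) (auto simp: rst_def JT1 I)
    also have "\<Phi> (J - T1) \<le> (1 + \<delta>a) * 2 powr (q / 2) * (real a powr (q / 2 - 1) * qpow_sum J q w)"
      using top_set_remainder_le[OF fin(2) a q(1), of "(1 + \<delta>a) * 2 powr (q / 2)" \<Phi> w T1] \<delta>a sub bd T1
      by simp
    also have "\<dots> \<le> (1 + \<delta>a) * 2 powr (q / 2) * (c * X)"
      using tailJ cX \<delta>a by (intro mult_left_mono) auto
    finally have "(1 - \<delta>sa) * (frame_gap \<rho> \<iota> q \<theta> powr (q / 2) * X)
        \<le> M + (1 + \<delta>a) * 2 powr (q / 2) * (c * X)"
      using meas by simp
    then have "L * X \<le> M"
      by (simp add: L recovery_margin_def c_def algebra_simps)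
    then have "X \<le> M / L" using L by (simp add: field_simps)
    then show ?thesis using nn \<theta> by (simp add: add_increasing2)
  qed
  moreover have "W powr (q / 2) \<le> 2 * X + e"
  proof -
    have "W powr (q / 2) \<le> X + R powr (q / 2)"
      unfolding WUR X_def using nn q by (intro powr_add_le_add_powr) auto
    \<comment> \<open>Since \<open>s < a\<close>, the ratio is at most 1, so the remainder costs no
      more than one further copy of \<open>X\<close> plus \<open>e\<close>.\<close>
    also have "\<rho> powr (1 - q / 2) \<le> 1"
      using sa q by (intro powr_le1) (auto simp: \<rho>)
    then have "\<rho> powr (1 - q / 2) * X \<le> 1 * X" using nn by (intro mult_right_mono)
    then have "X + R powr (q / 2) \<le> 2 * X + e" using RX by simp
    finally show ?thesis .
  qed
  ultimately show ?thesis using that headX by (simp add: W_def)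
qed

section \<open>Minimality, best approximation and the final constants\<close>

text \<open>The usual cone argument, with q-sums in place of norms as they obey the triangle
  inequality for \<open>q <= 1\<close>: mass that \<open>y\<close> gains off \<open>T\<close> must
  be paid for by mass lost on \<open>T\<close>.\<close>

lemma minimizer_cone:
  assumes fin: "finite I" and T: "T \<subseteq> I" and q: "0 < q" "q \<le> 1"
    and min: "pnorm I q y \<le> pnorm I q x"
  shows "qpow_sum (I - T) q (\<lambda>p. y p - x p)
    \<le> qpow_sum T q (\<lambda>p. y p - x p) + 2 * qpow_sum (I - T) q x"
proof -
  have split: "qpow_sum I q u = qpow_sum T q u + qpow_sum (I - T) q u" for u
    using sum.subset_diff[OF T fin, of "\<lambda>p. \<bar>u p\<bar> powr q"] by (simp add: qpow_sum_def)
  have "pnorm I q y powr q \<le> pnorm I q x powr q"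
    using min q by (intro powr_mono2) (auto simp: pnorm_def)
  then have "qpow_sum I q y \<le> qpow_sum I q x" using q by (simp add: pnorm_powr)
  moreover have "qpow_sum T q x \<le> qpow_sum T q (\<lambda>p. y p - x p) + qpow_sum T q y"
    using qpow_sum_add_le[of q T "\<lambda>p. x p - y p" y] q by (simp add: qpow_sum_def abs_minus_commute)
  moreover have "qpow_sum (I - T) q (\<lambda>p. y p - x p) \<le> qpow_sum (I - T) q y + qpow_sum (I - T) q x"
    using qpow_sum_add_le[of q "I - T" y "\<lambda>p. - x p"] q by (simp add: qpow_sum_def)
  ultimately show ?thesis using split[of x] split[of y] by linarith
qed

lemma best_s_tail:
  assumes "finite I"
  obtains T where "T \<subseteq> I" "card T \<le> s"
    and "qpow_sum I q (\<lambda>p. x p - best_s I s x p) = qpow_sum (I - T) q x"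
proof
  define T where "T = (SOME S. top_set I s x S)"
  have "top_set I s x T"
    unfolding T_def using top_set_exists[OF assms] by (rule someI_ex)
  then show "T \<subseteq> I" "card T \<le> s" by (auto simp: top_set_def)
  have "x p - best_s I s x p = (if p \<in> T then 0 else x p)" for p
    by (simp add: best_s_def T_def Let_def)
  then show "qpow_sum I q (\<lambda>p. x p - best_s I s x p) = qpow_sum (I - T) q x"
    unfolding qpow_sum_def using assms
    by (intro sum.mono_neutral_cong_right) auto
qed

theorem theorem3p1:
  shows "\<exists>C1 C2 C3 C4 :: real \<Rightarrow> real \<Rightarrow> real \<Rightarrow> nat \<Rightarrow> real \<Rightarrow> real.
    (\<forall>da dsa rho io q. C1 da dsa rho io q > 0 \<and> C2 da dsa rho io q > 0 \<and>
                        C3 da dsa rho io q > 0 \<and> C4 da dsa rho io q > 0) \<and>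
    (\<forall>(\<iota>::nat) (m::nat) (n::nat) (q::real) (r::ereal) (\<epsilon>::real)
       (A :: nat \<Rightarrow> nat \<Rightarrow> real) (d :: nat \<Rightarrow> nat) (D :: nat \<Rightarrow> nat \<Rightarrow> nat \<Rightarrow> real)
       (f :: nat \<Rightarrow> nat \<Rightarrow> real) (z :: nat \<Rightarrow> real) (y :: nat \<Rightarrow> real)
       (sk :: nat \<Rightarrow> nat) (s::nat) (a::nat) (fh :: nat \<Rightarrow> nat \<Rightarrow> real).
     0 < \<iota> \<and> 0 < m \<and> 0 < n \<and> 0 < q \<and> q \<le> 1 \<and> 1 \<le> r \<and> 0 \<le> \<epsilon> \<and>
     (\<forall>k<\<iota>. tight_frame1 n (d k) (D k)) \<and>
     (\<forall>i<m. y i = matvec n A (\<lambda>j. \<Sum>k<\<iota>. f k j) i + z i) \<and>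
     rnorm {..<m} r z \<le> \<epsilon> \<and>
     (\<forall>k<\<iota>. 0 < sk k) \<and> s = (\<Sum>k<\<iota>. sk k) \<and> s < a \<and>
     (\<exists>\<delta>. 0 \<le> \<delta> \<and> \<delta> < 1 \<and> rip_holds m n \<iota> d D A q a \<delta>) \<and>
     (\<exists>\<delta>. 0 \<le> \<delta> \<and> \<delta> < 1 \<and> rip_holds m n \<iota> d D A q (s + a) \<delta>) \<and>
     (let \<rho> = real s / real a;
          \<delta>a = rip_const m n \<iota> d D A q a;
          \<delta>sa = rip_const m n \<iota> d D A q (s + a);
          \<Delta> = (1 + \<delta>a) / (1 - \<delta>sa)
      in mutual_coherence n \<iota> d D * real (s + a) * (\<rho> powr (2 / q - 1) + 1) < 1 \<and>
         \<Delta> * \<rho> powr (1 - q / 2) * (\<rho> powr (2 / q - 1) + 1) powr (q / 2)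
           < (2 * real \<iota>) powr (- q / 2)) \<and>
     rnorm {..<m} r (\<lambda>i. matvec n A (Dbar_mult \<iota> d D (Psi_adj n D fh)) i - y i) \<le> \<epsilon> \<and>
     (\<forall>ft. rnorm {..<m} r (\<lambda>i. matvec n A (Dbar_mult \<iota> d D (Psi_adj n D ft)) i - y i) \<le> \<epsilon>
            \<longrightarrow> pnorm (coef_idx \<iota> d) q (Psi_adj n D fh) \<le> pnorm (coef_idx \<iota> d) q (Psi_adj n D ft))
     \<longrightarrow>
     (let \<rho> = real s / real a;
          \<delta>a = rip_const m n \<iota> d D A q a;
          \<delta>sa = rip_const m n \<iota> d D A q (s + a);
          x = Psi_adj n D f;
          I = coef_idx \<iota> d;
          tail = (\<lambda>p. x p - best_s I s x p)
      in pnorm ({..<\<iota>} \<times> {..<n}) 2 (\<lambda>p. fh (fst p) (snd p) - f (fst p) (snd p))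
           \<le> C1 \<delta>a \<delta>sa \<rho> \<iota> q * pnorm I q tail / real s powr (1 / q - 1 / 2)
             + C2 \<delta>a \<delta>sa \<rho> \<iota> q * real m powr (1 / q - einv r) * \<epsilon> \<and>
         qpow_sum I q (\<lambda>p. Psi_adj n D fh p - x p)
           \<le> C3 \<delta>a \<delta>sa \<rho> \<iota> q * qpow_sum I q tail
             + C4 \<delta>a \<delta>sa \<rho> \<iota> q * real a powr (1 - q / 2) * real m powr (1 - q * einv r) * \<epsilon> powr q))"
proof -
  \<comment> \<open>Choosing \<theta> as a function of the five parameters alone makes the constants
    uniform. Its positivity stands outside the implication because the constants must be positive
    for all arguments, even those violating the hypotheses.\<close>
  define ok where "ok \<delta>a \<delta>sa \<rho> \<iota> q \<theta> \<longleftrightarrow> 0 < \<theta> \<and> (0 < q \<and> q \<le> 1 \<and> 0 < \<rho> \<and> 0 < \<iota> \<and> \<delta>sa < 1 \<and>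
      (1 + \<delta>a) / (1 - \<delta>sa) * \<rho> powr (1 - q / 2) * (\<rho> powr (2 / q - 1) + 1) powr (q / 2)
        < (2 * real \<iota>) powr (- q / 2)
      \<longrightarrow> 0 < frame_gap \<rho> \<iota> q \<theta> \<and> 0 < recovery_margin \<delta>a \<delta>sa \<rho> \<iota> q \<theta>)"
    for \<delta>a \<delta>sa \<rho> :: real and \<iota> :: nat and q \<theta> :: real
  have "\<exists>\<theta>. ok \<delta>a \<delta>sa \<rho> \<iota> q \<theta>" for \<delta>a \<delta>sa \<rho> \<iota> q
    unfolding ok_def using recovery_margin_pos[of q \<rho> \<iota> \<delta>sa \<delta>a] zero_less_one by blast
  then have ex: "ok \<delta>a \<delta>sa \<rho> \<iota> q (SOME \<theta>. ok \<delta>a \<delta>sa \<rho> \<iota> q \<theta>)" for \<delta>a \<delta>sa \<rho> \<iota> q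
    by (rule someI_ex)
  define \<theta> where "\<theta> \<delta>a \<delta>sa \<rho> \<iota> q = (SOME \<theta>. ok \<delta>a \<delta>sa \<rho> \<iota> q \<theta>)" for \<delta>a \<delta>sa \<rho> \<iota> q
  have ok: "ok \<delta>a \<delta>sa \<rho> \<iota> q (\<theta> \<delta>a \<delta>sa \<rho> \<iota> q)" for \<delta>a \<delta>sa \<rho> \<iota> q
    unfolding \<theta>_def by (rule ex)
  have \<theta>_pos: "0 < \<theta> \<delta>a \<delta>sa \<rho> \<iota> q" for \<delta>a \<delta>sa \<rho> \<iota> q
    using ok unfolding ok_def by blast
  have \<theta>: "0 < frame_gap \<rho> \<iota> q (\<theta> \<delta>a \<delta>sa \<rho> \<iota> q) \<and> 0 < recovery_margin \<delta>a \<delta>sa \<rho> \<iota> q (\<theta> \<delta>a \<delta>sa \<rho> \<iota> q)"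
    if "0 < q" "q \<le> 1" "0 < \<rho>" "0 < \<iota>" "\<delta>sa < 1"
      "(1 + \<delta>a) / (1 - \<delta>sa) * \<rho> powr (1 - q / 2) * (\<rho> powr (2 / q - 1) + 1) powr (q / 2)
        < (2 * real \<iota>) powr (- q / 2)" for \<delta>a \<delta>sa \<rho> \<iota> q
    using ok[of \<delta>a \<delta>sa \<rho> \<iota> q] that unfolding ok_def by blast
  \<comment> \<open>The value 1 is a default keeping \<open>L\<close> positive where the margin is
    not.\<close>
  define L where "L \<delta>a \<delta>sa \<rho> \<iota> q = (let l = recovery_margin \<delta>a \<delta>sa \<rho> \<iota> q (\<theta> \<delta>a \<delta>sa \<rho> \<iota> q)
    in if 0 < l then l else 1)" for \<delta>a \<delta>sa \<rho> \<iota> q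
  have L_pos: "0 < L \<delta>a \<delta>sa \<rho> \<iota> q" for \<delta>a \<delta>sa \<rho> \<iota> q
    by (simp add: L_def Let_def)
  \<comment> \<open>All four constants come from inserting \<open>X \<le> M / l + e / t\<close> into
    the other two estimates. The outer \<open>2 powr (1 / q)\<close> in \<open>C1\<close> and
    \<open>C2\<close> is the quasi-triangle constant of \<open>add_powr_le\<close>; the further
    factor 2 in \<open>C1\<close> comes from \<open>2 * \<sigma>\<close> in \<open>e\<close>, the
    last one in \<open>C2\<close> from \<open>2 * \<epsilon>\<close> in \<open>M\<close>.\<close>
  define C1 where "C1 \<delta>a \<delta>sa \<rho> \<iota> q
    = 2 powr (1 / q) * (2 * (2 / \<theta> \<delta>a \<delta>sa \<rho> \<iota> q + 1)) powr (1 / q)" for \<delta>a \<delta>sa \<rho> \<iota> q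
  define C2 where "C2 \<delta>a \<delta>sa \<rho> \<iota> q
    = 2 powr (1 / q) * ((2 / L \<delta>a \<delta>sa \<rho> \<iota> q) powr (1 / q) * 2)" for \<delta>a \<delta>sa \<rho> \<iota> q
  define C3 where "C3 \<delta>a \<delta>sa \<rho> \<iota> q = 4 / \<theta> \<delta>a \<delta>sa \<rho> \<iota> q + 2" for \<delta>a \<delta>sa \<rho> \<iota> q
  define C4 where "C4 \<delta>a \<delta>sa \<rho> \<iota> q = 2 / L \<delta>a \<delta>sa \<rho> \<iota> q * 2 powr q" for \<delta>a \<delta>sa \<rho> \<iota> q
  have C_pos: "0 < C1 \<delta>a \<delta>sa \<rho> \<iota> q" "0 < C2 \<delta>a \<delta>sa \<rho> \<iota> q"
    "0 < C3 \<delta>a \<delta>sa \<rho> \<iota> q" "0 < C4 \<delta>a \<delta>sa \<rho> \<iota> q" for \<delta>a \<delta>sa \<rho> \<iota> q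
    using \<theta>_pos[of \<delta>a \<delta>sa \<rho> \<iota> q] L_pos[of \<delta>a \<delta>sa \<rho> \<iota> q]
    by (simp_all add: C1_def C2_def C3_def C4_def add_nonneg_pos order_less_imp_not_eq2)
  show ?thesis
    unfolding Let_def
  proof (rule exI[of _ C1], rule exI[of _ C2], rule exI[of _ C3], rule exI[of _ C4],
      intro conjI[of "\<forall>da dsa rho io q. _ da dsa rho io q"] allI impI, goal_cases)
    case 1
    show ?case using C_pos by blast
  next
    case prems: (2 \<iota> m n q r \<epsilon> A d D f z y sk s a fh)
    define I where "I = coef_idx \<iota> d"
    define x where "x = Psi_adj n D f"
    define \<rho> where "\<rho> = real s / real a"
    define \<delta>a where "\<delta>a = rip_const m n \<iota> d D A q a"
    define \<delta>sa where "\<delta>sa = rip_const m n \<iota> d D A q (s + a)"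
    from prems have \<iota>: "0 < \<iota>" and m: "0 < m" and q: "0 < q" "q \<le> 1" and r: "1 \<le> r" and \<epsilon>: "0 \<le> \<epsilon>"
      and frames: "\<And>k. k < \<iota> \<Longrightarrow> tight_frame1 n (d k) (D k)"
      and y: "\<And>i. i < m \<Longrightarrow> y i = matvec n A (\<lambda>j. \<Sum>k<\<iota>. f k j) i + z i"
      and z: "rnorm {..<m} r z \<le> \<epsilon>"
      and sk: "\<And>k. k < \<iota> \<Longrightarrow> 0 < sk k" "s = (\<Sum>k<\<iota>. sk k)" and sa: "s < a"
      and ex_a: "\<exists>\<delta>. 0 \<le> \<delta> \<and> \<delta> < 1 \<and> rip_holds m n \<iota> d D A q a \<delta>"
      and ex_sa: "\<exists>\<delta>. 0 \<le> \<delta> \<and> \<delta> < 1 \<and> rip_holds m n \<iota> d D A q (s + a) \<delta>"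
      and coh: "mutual_coherence n \<iota> d D * real (s + a) * (\<rho> powr (2 / q - 1) + 1) < 1"
      and cond: "(1 + \<delta>a) / (1 - \<delta>sa) * \<rho> powr (1 - q / 2) * (\<rho> powr (2 / q - 1) + 1) powr (q / 2)
        < (2 * real \<iota>) powr (- q / 2)"
      and feas: "rnorm {..<m} r (\<lambda>i. matvec n A (Dbar_mult \<iota> d D (Psi_adj n D fh)) i - y i) \<le> \<epsilon>"
      and opt: "\<And>ft. rnorm {..<m} r (\<lambda>i. matvec n A (Dbar_mult \<iota> d D (Psi_adj n D ft)) i - y i) \<le> \<epsilon>
        \<Longrightarrow> pnorm I q (Psi_adj n D fh) \<le> pnorm I q (Psi_adj n D ft)"
      unfolding I_def \<rho>_def \<delta>a_def \<delta>sa_def by blast+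
    note isometry = Psi_adj_isometry[where \<iota> = \<iota> and d = d and D = D and n = n, OF frames]
    note reconstruct = Dbar_mult_Psi_adj[where \<iota> = \<iota> and d = d and D = D and n = n, OF frames]
    have s: "0 < s" using sk \<iota> by (auto simp: intro!: sum_pos)
    have \<rho>: "0 < \<rho>" using s sa by (simp add: \<rho>_def)
    note rip_a = rip_const_nonneg[OF ex_a] rip_holds_rip_const[OF ex_a]
    note rip_sa = rip_const_less_1[OF ex_sa] rip_holds_rip_const[OF ex_sa]
    define t where "t = \<theta> \<delta>a \<delta>sa \<rho> \<iota> q"
    define l where "l = L \<delta>a \<delta>sa \<rho> \<iota> q"
    have t: "0 < t" and l: "0 < l" by (simp_all add: t_def l_def \<theta>_pos L_pos)
    have marg: "0 < frame_gap \<rho> \<iota> q t" "0 < recovery_margin \<delta>a \<delta>sa \<rho> \<iota> q t"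
      using \<theta>[OF q \<rho> \<iota> _ cond] rip_sa(1) by (auto simp: t_def \<delta>sa_def)
    then have l_eq: "l = recovery_margin \<delta>a \<delta>sa \<rho> \<iota> q t"
      by (simp add: l_def L_def Let_def t_def)
    define h where "h k i = fh k i - f k i" for k i
    define w where "w = Psi_adj n D h"
    have w: "w p = Psi_adj n D fh p - x p" for p
      by (simp add: w_def x_def Psi_adj_def h_def right_diff_distrib sum_subtractf)
    define M where "M = real m powr (1 - q * einv r) * (2 * \<epsilon>) powr q"
    \<comment> \<open>Frame reconstruction makes \<open>f\<close> feasible: its residual is
      \<open>- z\<close> on the first \<open>m\<close> entries.\<close>
    have ADx: "matvec n A (Dbar_mult \<iota> d D x) i = matvec n A (\<lambda>j. \<Sum>k<\<iota>. f k j) i" for i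
      unfolding matvec_def x_def by (intro sum.cong refl) (simp add: reconstruct)
    have "rnorm {..<m} r u = rnorm {..<m} r z" if "\<And>i. i < m \<Longrightarrow> u i = - z i" for u
    proof -
      have "(\<lambda>i. \<bar>u i\<bar>) ` {..<m} = (\<lambda>i. \<bar>z i\<bar>) ` {..<m}" using that by (intro image_cong) auto
      then show ?thesis using that by (auto simp: rnorm_def pnorm_def qpow_sum_def)
    qed
    then have res_f: "rnorm {..<m} r (\<lambda>i. matvec n A (Dbar_mult \<iota> d D x) i - y i) \<le> \<epsilon>"
      using z y by (simp add: ADx)
    \<comment> \<open>The observation \<open>y\<close> cancels, so the measurement of
      \<open>w\<close> is a difference of two feasible residuals.\<close>
    have "Dbar_mult \<iota> d D w j = Dbar_mult \<iota> d D (Psi_adj n D fh) j - Dbar_mult \<iota> d D x j" for j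
      by (simp add: Dbar_mult_def w right_diff_distrib sum_subtractf)
    then have "matvec n A (Dbar_mult \<iota> d D w) = (\<lambda>i. (matvec n A (Dbar_mult \<iota> d D (Psi_adj n D fh)) i - y i)
        - (matvec n A (Dbar_mult \<iota> d D x) i - y i))"
      by (simp add: matvec_def right_diff_distrib sum_subtractf)
    then have meas: "qpow_sum {..<m} q (matvec n A (Dbar_mult \<iota> d D w)) \<le> M"
      using rnorm_diff_powr_le[OF r q m \<epsilon> feas res_f] by (simp add: M_def)
    obtain T where T: "T \<subseteq> I" "card T \<le> s"
      and tail: "qpow_sum I q (\<lambda>p. x p - best_s I s x p) = qpow_sum (I - T) q x"
      using best_s_tail[of I s q x] by (auto simp: I_def)
    define \<sigma> where "\<sigma> = qpow_sum (I - T) q x"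
    have \<sigma>: "0 \<le> \<sigma>" by (simp add: \<sigma>_def)
    have cone: "qpow_sum (I - T) q w \<le> qpow_sum T q w + 2 * \<sigma>"
      using minimizer_cone[OF _ T(1) q opt[of f, OF res_f[unfolded x_def]]]
      by (simp add: \<sigma>_def w[abs_def] I_def x_def)
    define e where "e = 2 * \<sigma> * real a powr (q / 2 - 1)"
    have e: "0 \<le> e" using \<sigma> by (simp add: e_def)
    obtain X where X: "qpow_sum T q w \<le> real s powr (1 - q / 2) * X"
      "X \<le> M / l + e / t" "(\<Sum>p\<in>I. (w p)\<^sup>2) powr (q / 2) \<le> 2 * X + e"
      using error_estimate[OF \<iota> q s sa frames rip_a(2,1) rip_sa(2,1) \<rho>_def coh t
          marg(1)[unfolded \<delta>a_def \<delta>sa_def] l_eq[unfolded \<delta>a_def \<delta>sa_def] l w_def I_def T _ cone meas e_def] \<sigma>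
      by auto
    have M: "0 \<le> M" by (simp add: M_def)
    have err: "pnorm ({..<\<iota>} \<times> {..<n}) 2 (\<lambda>p. fh (fst p) (snd p) - f (fst p) (snd p))
        \<le> C1 \<delta>a \<delta>sa \<rho> \<iota> q * pnorm I q (\<lambda>p. x p - best_s I s x p) / real s powr (1 / q - 1 / 2)
          + C2 \<delta>a \<delta>sa \<rho> \<iota> q * real m powr (1 / q - einv r) * \<epsilon>"
    proof -
      define W where "W = (\<Sum>p\<in>I. (w p)\<^sup>2)"
      have "W = (\<Sum>p\<in>{..<\<iota>} \<times> {..<n}. (fh (fst p) (snd p) - f (fst p) (snd p))\<^sup>2)"
        by (simp add: W_def w_def I_def isometry h_def sum.cartesian_product case_prod_unfold)
      then have "pnorm ({..<\<iota>} \<times> {..<n}) 2 (\<lambda>p. fh (fst p) (snd p) - f (fst p) (snd p)) = W powr (1 / 2)"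
        by (simp add: pnorm_def qpow_sum_two)
      also have "\<dots> = (W powr (q / 2)) powr (1 / q)" using q by (simp add: powr_powr)
      also have "\<dots> \<le> ((2 / t + 1) * e + 2 / l * M) powr (1 / q)"
      proof (intro powr_mono2)
        have "W powr (q / 2) \<le> 2 * (M / l + e / t) + e" using X(2,3) by (simp add: W_def)
        then show "W powr (q / 2) \<le> (2 / t + 1) * e + 2 / l * M" by (simp add: algebra_simps)
      qed (use q in auto)
      also have "\<dots> \<le> 2 powr (1 / q) * (((2 / t + 1) * e) powr (1 / q) + (2 / l * M) powr (1 / q))"
        using t l e M q by (intro add_powr_le) auto
      also have "((2 / t + 1) * e) powr (1 / q)
          = (2 * (2 / t + 1)) powr (1 / q) * (\<sigma> powr (1 / q) * real a powr (1 / 2 - 1 / q))"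
      proof -
        have "(2 / t + 1) * e = 2 * (2 / t + 1) * (\<sigma> * real a powr (q / 2 - 1))"
          by (simp add: e_def)
        moreover have "(q / 2 - 1) * (1 / q) = 1 / 2 - 1 / q" using q by (simp add: field_simps)
        ultimately show ?thesis by (simp only: powr_mult powr_powr)
      qed
      \<comment> \<open>The exponent \<open>1 / 2 - 1 / q\<close> is negative, so replacing
        \<open>a\<close> by the smaller \<open>s\<close> enlarges the power and yields the scaling
        in the claim.\<close>
      also have "\<dots> \<le> (2 * (2 / t + 1)) powr (1 / q) * (\<sigma> powr (1 / q) * (1 / real s powr (1 / q - 1 / 2)))"
      proof (intro mult_left_mono)
        have "2 * q \<le> 2" using q by simp
        then have "1 / 2 \<le> 1 / q" using q by (simp add: field_simps)
        then have "real a powr (1 / 2 - 1 / q) \<le> real s powr (1 / 2 - 1 / q)"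
          using s sa by (intro powr_mono2') auto
        then show "real a powr (1 / 2 - 1 / q) \<le> 1 / real s powr (1 / q - 1 / 2)"
          using powr_minus_divide[of "real s" "1 / q - 1 / 2"] by simp
      qed auto
      also have "(2 / l * M) powr (1 / q) = (2 / l) powr (1 / q) * 2 * (real m powr (1 / q - einv r) * \<epsilon>)"
      proof -
        have "M powr (1 / q) = real m powr ((1 - q * einv r) * (1 / q)) * (2 * \<epsilon>)"
          using q \<epsilon> by (simp add: M_def powr_mult powr_powr)
        also have "(1 - q * einv r) * (1 / q) = 1 / q - einv r" using q by (simp add: field_simps)
        finally show ?thesis by (simp only: powr_mult mult_ac)
      qed
      finally show ?thesis
        by (simp add: C1_def C2_def t_def l_def pnorm_def tail \<sigma>_def algebra_simps)
    qed
    have coef: "qpow_sum I q (\<lambda>p. Psi_adj n D fh p - x p)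
        \<le> C3 \<delta>a \<delta>sa \<rho> \<iota> q * qpow_sum I q (\<lambda>p. x p - best_s I s x p)
          + C4 \<delta>a \<delta>sa \<rho> \<iota> q * real a powr (1 - q / 2) * real m powr (1 - q * einv r) * \<epsilon> powr q"
    proof -
      have "qpow_sum I q w = qpow_sum T q w + qpow_sum (I - T) q w"
        using sum.subset_diff[OF T(1), of "\<lambda>p. \<bar>w p\<bar> powr q"] by (simp add: I_def qpow_sum_def)
      also have "\<dots> \<le> 2 * qpow_sum T q w + 2 * \<sigma>" using cone by simp
      \<comment> \<open>Here \<open>s\<close> is enlarged to \<open>a\<close>, so that the power
        cancels against the one in \<open>e\<close> and \<sigma> keeps a coefficient free of
        \<open>a\<close>.\<close>
      also have "qpow_sum T q w \<le> real a powr (1 - q / 2) * (M / l + e / t)"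
      proof -
        have B: "0 \<le> M / l + e / t" using M l e t by simp
        have "real s powr (1 - q / 2) * X \<le> real s powr (1 - q / 2) * (M / l + e / t)"
          using X(2) by (intro mult_left_mono) auto
        also have "\<dots> \<le> real a powr (1 - q / 2) * (M / l + e / t)"
          using sa q B by (intro mult_right_mono powr_mono2) auto
        finally show ?thesis using X(1) by linarith
      qed
      also have "2 * (real a powr (1 - q / 2) * (M / l + e / t)) + 2 * \<sigma>
          = (4 / t * (real a powr (1 - q / 2) * real a powr (q / 2 - 1)) + 2) * \<sigma>
            + 2 / l * real a powr (1 - q / 2) * M"
        by (simp add: e_def algebra_simps)
      also have "real a powr (1 - q / 2) * real a powr (q / 2 - 1) = 1"
        using sa by (simp flip: powr_add)
      finally show ?thesis
        by (simp add: w[abs_def] C3_def C4_def t_def l_def tail \<sigma>_def M_def powr_mult ac_simps)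
    qed
    show ?case
      using err coef unfolding I_def x_def \<rho>_def \<delta>a_def \<delta>sa_def by blast
  qed
qed

end
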